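(* Let $p\ge 7$ be a prime, $\mathbb{K}=\overline{\mathbb{F}}_p$, and let $V$ be the irreducible non-singular curve in $\mathrm{PG}(p-2,\mathbb{K})$, defined over $\mathbb{F}_p$, given by the equations $X_1^k+X_2^k+\cdots+X_{p-1}^k=0$ for $1\le k\le p-3$, regarded as a curve in the hyperplane $X_1+\cdots+X_{p-1}=0$, which is identified with $\mathrm{PG}(p-3,\mathbb{K})$. Let $P$ be any $\mathbb{F}_p$-rational point of $V$. Then each of the integers $1,2,3$ occurs as an intersection multiplicity $I(P,V\cap\pi)$ for some hyperplane $\pi$ of $\mathrm{PG}(p-3,\mathbb{K})$. Furthermore, the last order of $V$ at $P$ is at least $2p-4$.
   Context: $I(P,V\cap\pi)$ is the intersection multiplicity of $V$ with the hyperplane $\pi$ at $P$. As $\pi$ ranges over all hyperplanes of $\mathrm{PG}(p-3,\mathbb{K})$, these multiplicities take exactly $p-2$ values $0=j_0(P)<j_1(P)<\cdots<j_{p-3}(P)$, called the orders of $V$ at $P$; the last order is $j_{p-3}(P)$, the maximum intersection multiplicity at $P$ of $V$ with a hyperplane. *)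

theory Defs
  imports
    "HOL-Library.Poly_Mapping"
    "HOL-Library.Extended_Nat"
    "HOL-Computational_Algebra.Fraction_Field"
    "HOL-Algebra.Algebraic_Closure_Type"
    "Berlekamp_Zassenhaus.Finite_Field"
begin

text \<open>
  Points of \<open>PG(n - 1, K)\<close> are given by homogeneous coordinate vectors \<open>x :: nat \<Rightarrow> K\<close>, of which
  only the coordinates \<open>x 1, \<dots>, x n\<close> matter, not all of them zero. Every notion below is invariant
  under scaling of the coordinate vector.
\<close>

type_synonym 'k mpoly = "(nat \<Rightarrow>\<^sub>0 nat) \<Rightarrow>\<^sub>0 'k"

definition mpolys :: "nat \<Rightarrow> 'k::field mpoly set" where
  "mpolys n = {F. \<forall>m\<in>Poly_Mapping.keys F. Poly_Mapping.keys m \<subseteq> {1..n}}"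

definition homog :: "nat \<Rightarrow> nat \<Rightarrow> 'k::field mpoly set" where
  "homog n d = {F \<in> mpolys n. \<forall>m\<in>Poly_Mapping.keys F.
     (\<Sum>i\<in>Poly_Mapping.keys m. Poly_Mapping.lookup m i) = d}"

definition mpoly_eval :: "(nat \<Rightarrow> 'k) \<Rightarrow> 'k::field mpoly \<Rightarrow> 'k" where
  "mpoly_eval x F = (\<Sum>m\<in>Poly_Mapping.keys F. Poly_Mapping.lookup F m *
     (\<Prod>i\<in>Poly_Mapping.keys m. x i ^ Poly_Mapping.lookup m i))"

definition linear_form :: "nat \<Rightarrow> (nat \<Rightarrow> 'k) \<Rightarrow> 'k::field mpoly" where
  "linear_form n a = (\<Sum>i\<in>{1..n}. Poly_Mapping.single (Poly_Mapping.single i 1) (a i))"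

definition proj_points :: "nat \<Rightarrow> (nat \<Rightarrow> 'k::field) set" where
  "proj_points n = {x. \<exists>i\<in>{1..n}. x i \<noteq> 0}"

definition vanishing_ideal :: "nat \<Rightarrow> (nat \<Rightarrow> 'k) set \<Rightarrow> 'k::field mpoly set" where
  "vanishing_ideal n V = {F \<in> mpolys n. \<forall>x\<in>V. mpoly_eval x F = 0}"

text \<open>
  Degree-zero part of the localization at the point \<open>P\<close> of a homogeneous ideal \<open>J\<close>, as a set of
  elements of the field of rational functions. For \<open>J = mpolys n\<close> this is the local ring of
  \<open>PG(n - 1, K)\<close> at \<open>P\<close>; for other \<open>J\<close> it is the ideal that \<open>J\<close> induces in that local ring.
\<close>

definition localize :: "nat \<Rightarrow> 'k mpoly set \<Rightarrow> (nat \<Rightarrow> 'k) \<Rightarrow> 'k::field mpoly fract set" where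
  "localize n J P =
     {Fract F G | F G d. F \<in> J \<inter> homog n d \<and> G \<in> homog n d \<and> mpoly_eval P G \<noteq> 0}"

definition const_fract :: "'k::field \<Rightarrow> 'k mpoly fract" where
  "const_fract c = Fract (Poly_Mapping.single 0 c) 1"

text \<open>
  The dimension over \<open>K\<close> of the quotient \<open>U / W\<close> of \<open>K\<close>-subspaces \<open>W \<subseteq> U\<close> of the field of rational
  functions, i.e. the least size of a finite subset of \<open>U\<close> that spans \<open>U\<close> modulo \<open>W\<close>. It is \<open>\<infinity>\<close> if
  there is no such subset (\<open>Inf {} = \<infinity>\<close> in \<open>enat\<close>).
\<close>

definition quotient_dim :: "'k::field mpoly fract set \<Rightarrow> 'k mpoly fract set \<Rightarrow> enat" where
  "quotient_dim U W =
     Inf {enat (card B) | B. finite B \<and> B \<subseteq> U \<and>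
            (\<forall>f\<in>U. \<exists>c. f - (\<Sum>b\<in>B. const_fract (c b) * b) \<in> W)}"

text \<open>
  \<open>I(P, V \<inter> \<pi>)\<close>, where \<open>\<pi>\<close> is the zero set of the linear form \<open>\<ell>\<close> with coefficients \<open>a\<close>: the
  dimension of \<open>\<O>\<^bsub>V,P\<^esub> / (\<ell>)\<close>. As \<open>\<O>\<^bsub>V,P\<^esub>\<close> is the quotient of the local ring of the ambient space by
  the ideal induced by \<open>I(V)\<close>, this is the quotient of the ambient local ring by the ideal induced by
  \<open>I(V) + (\<ell>)\<close>.
\<close>

definition intersection_mult ::
    "nat \<Rightarrow> (nat \<Rightarrow> 'k) set \<Rightarrow> (nat \<Rightarrow> 'k::field) \<Rightarrow> (nat \<Rightarrow> 'k) \<Rightarrow> enat" where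
  "intersection_mult n V P a =
     quotient_dim (localize n (mpolys n) P)
       (localize n {A + linear_form n a * B | A B. A \<in> vanishing_ideal n V \<and> B \<in> mpolys n} P)"

definition power_sum_curve :: "nat \<Rightarrow> (nat \<Rightarrow> 'k::field) set" where
  "power_sum_curve p =
     {x \<in> proj_points (p - 1). \<forall>k\<in>{1..p - 3}. (\<Sum>i\<in>{1..p - 1}. x i ^ k) = 0}"

text \<open>
  \<open>PG(p - 3, K)\<close> is the hyperplane \<open>X\<^sub>1 + \<dots> + X\<^bsub>p-1\<^esub> = 0\<close> of \<open>PG(p - 2, K)\<close>. The linear form with
  coefficients \<open>a\<close> cuts out a hyperplane of \<open>PG(p - 3, K)\<close> iff it does not vanish identically
  there, and every hyperplane of \<open>PG(p - 3, K)\<close> arises in this way.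
\<close>

definition is_hyperplane :: "nat \<Rightarrow> (nat \<Rightarrow> 'k::field) \<Rightarrow> bool" where
  "is_hyperplane p a \<longleftrightarrow>
     (\<exists>x. (\<Sum>i\<in>{1..p - 1}. x i) = 0 \<and> (\<Sum>i\<in>{1..p - 1}. a i * x i) \<noteq> 0)"

definition curve_orders :: "nat \<Rightarrow> (nat \<Rightarrow> 'k::field) \<Rightarrow> nat set" where
  "curve_orders p P =
     {j. \<exists>a. is_hyperplane p a \<and> intersection_mult (p - 1) (power_sum_curve p) P a = enat j}"

definition last_order :: "nat \<Rightarrow> (nat \<Rightarrow> 'k::field) \<Rightarrow> nat" where
  "last_order p P = Max (curve_orders p P)"

text \<open>Rationality over \<open>F\<^sub>p\<close>: some coordinate vector of the point has all its entries in \<open>F\<^sub>p\<close>.\<close>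

definition rational_point :: "nat \<Rightarrow> (nat \<Rightarrow> 'q::prime_card mod_ring alg_closure) \<Rightarrow> bool" where
  "rational_point n P \<longleftrightarrow> (\<exists>c. c \<noteq> 0 \<and> (\<forall>i\<in>{1..n}. c * P i \<in> range to_ac))"

end

theory Submission
  imports
    Defs
    "HOL-Library.FuncSet"
    "HOL-Computational_Algebra.Computational_Algebra"
begin

text \<open>
  By Newton's identities the coordinates of a point of the curve are the roots of a trinomial
  \<open>T\<^bsup>p-1\<^esup> + a T + b\<close>, and a rational point is, up to scaling, a permutation \<open>\<theta>\<close> of the elements of
  \<open>F\<^sub>p\<^sup>*\<close> (\<open>a = 0\<close>, \<open>b = -1\<close>). The branch at \<open>\<theta>\<close> is given by the solutions
  \<open>X\<^sub>i = \<Sum>\<^sub>k c\<^sub>k \<theta>\<^sub>i\<^bsup>k+1\<^esup> t\<^sup>k\<close> of \<open>X\<^bsup>p-1\<^esup> + t X - 1 = 0\<close>, whose coefficients satisfy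
  \<open>c\<^sub>k = c\<^bsub>k/p\<^esub> + \<Sum> c\<^sub>i c\<^bsub>k-1-i\<^esub>\<close>. The function \<open>a\<close> is a uniformizer, so the intersection
  multiplicity with a hyperplane is the order in \<open>t\<close> of its linear form along the branch. The form
  \<open>\<Sum>\<^sub>i \<theta>\<^sub>i\<^bsup>p-2-j\<^esup> X\<^sub>i\<close> picks out the exponents congruent to \<open>j\<close> modulo \<open>p - 1\<close>. Its order is \<open>j\<close>
  for \<open>j = 1, 2, 3\<close>, because \<open>c\<^sub>j\<close> is the Catalan number \<open>1, 2, 5\<close>; for \<open>j = p - 3\<close> we have
  \<open>c\<^bsub>p-3\<^esub> = 0\<close>, so that the order is at least \<open>p - 3 + (p - 1) = 2 p - 4\<close>. That this order is finite
  is seen by tracing nonzero coefficients of \<open>f\<^sup>j / (1 - 2 t f)\<close>, with \<open>f = \<Sum>\<^sub>k c\<^sub>k t\<^sup>k\<close>, along the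
  sections \<open>m \<mapsto> p m + 1\<close> of the exponents.
\<close>

section \<open>Branches of the trinomial\<close>

text \<open>The multiplicity is defined through the ideal of all polynomials vanishing on a set of
  points over K, which is not given by generators. Reading it off as an order in t takes two facts.
  First, a polynomial vanishing on the curve must vanish along the formal branch, which is not a
  point over K; the transfer works because the power sums of the branch and of every fibre a = t, b
  = -1 are the same polynomials in t. Second, a form of order at least m along the branch must be a
  multiple of a^m modulo the ideal, locally at the point; this follows from the explicit relation
  X_j^(p-1) - X_1^(p-1) + a (X_j - X_1), which vanishes on the curve. The other obstacle is
  finiteness: if the form with j = p - 3 vanished along the branch, its multiplicity would be
  infinite and give no order. A nonzero coefficient c_k with k congruent to -2 modulo p - 1 is not
  visible directly. It is found through f' = f^2 / u with u = 1 - 2 t f, because taking exponents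
  congruent to 1 modulo p turns f^j / u into (j + 2) f^(j+1) / u, up to j = p - 2, where the
  constant term has the right residue.\<close>

lemma fps_power_CHAR_nth:
  fixes F :: "'a::comm_ring_1 fps"
  assumes p: "prime p" "CHAR('a) = p"
  shows "(F ^ p) $ k = (if p dvd k then (F $ (k div p)) ^ p else 0)"
proof -
  have p0: "p > 0" using p(1) prime_gt_0_nat by blast
  \<comment> \<open>Frobenius is additive on finite sums, so \<open>F\<close> is cut after degree
    \<open>k\<close>; the \<open>p\<close>-th power of the tail starts in degree
    \<open>Suc k * p\<close>, beyond \<open>k\<close>.\<close>
  define C where "C = (\<Sum>i\<le>k. fps_const (F $ i) * fps_X ^ i)"
  have cut: "F = fps_shift (Suc k) F * fps_X ^ Suc k + C"
  proof -
    have "fps_cutoff (Suc k) F = C"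
      by (rule fps_ext) (auto simp: C_def fps_sum_nth fps_X_power_nth mult_delta_right)
    with fps_shift_cutoff'[of "Suc k" F] show ?thesis by (simp add: mult.commute)
  qed
  have "F ^ p = fps_shift (Suc k) F ^ p * fps_X ^ (Suc k * p) + C ^ p"
    by (subst cut, subst freshmans_dream) (simp_all add: p power_mult_distrib power_add flip: power_mult)
  moreover have "(fps_shift (Suc k) F ^ p * fps_X ^ (Suc k * p)) $ k = 0"
  proof -
    have "k < Suc k * p" using p0 by (metis less_Suc_eq_le mult_le_mono2 mult.right_neutral Suc_leI le_trans lessI less_le_trans One_nat_def)
    thus ?thesis by (simp only: fps_X_power_mult_right_nth if_True)
  qed
  moreover have "C ^ p = (\<Sum>i\<le>k. fps_const ((F $ i) ^ p) * fps_X ^ (i * p))"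
    unfolding C_def by (subst freshmans_dream_sum) (simp_all add: p power_mult_distrib fps_const_power flip: power_mult)
  ultimately have "(F ^ p) $ k = (\<Sum>i\<le>k. if k = i * p then (F $ i) ^ p else 0)"
    by (simp add: fps_sum_nth fps_X_power_nth if_distrib cong: if_cong)
  also have "\<dots> = (if p dvd k then (F $ (k div p)) ^ p else 0)"
  proof (cases "p dvd k")
    case True
    then have "(\<Sum>i\<le>k. if k = i * p then (F $ i) ^ p else 0) = (\<Sum>i\<le>k. if i = k div p then (F $ i) ^ p else 0)"
      using p0 by (intro sum.cong) auto
    then show ?thesis using True by simp
  qed (auto intro!: sum.neutral)
  finally show ?thesis .
qed

text \<open>Coefficients of the solution of f = f^p + X f^2 with constant term 1. Being images of
  natural numbers they are fixed by Frobenius, so f^p = f(X^p), which contributes the term at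
  \<open>k div p\<close>. The guard \<open>1 < p\<close> ensures termination.\<close>

function branch_coeff :: "nat \<Rightarrow> nat \<Rightarrow> nat" where
  "branch_coeff p k = (if k = 0 then 1
     else (if 1 < p \<and> p dvd k then branch_coeff p (k div p) else 0)
       + (\<Sum>i<k. branch_coeff p i * branch_coeff p (k - 1 - i)))"
  by auto
termination by (relation "measure snd") auto

declare branch_coeff.simps [simp del]

text \<open>This is \<theta> f(\<theta> X) for f = \<open>branch p 1\<close>. The substitution
  preserves the equation f = f^p + X f^2 when \<open>\<theta> ^ p = \<theta>\<close>, so one
  coefficient sequence serves all coordinates.\<close>

definition branch :: "nat \<Rightarrow> 'a::comm_ring_1 \<Rightarrow> 'a fps" where
  "branch p \<theta> = Abs_fps (\<lambda>k. of_nat (branch_coeff p k) * \<theta> ^ Suc k)"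

lemma branch_nth_0 [simp]: "branch p \<theta> $ 0 = \<theta>"
  by (simp add: branch_def branch_coeff.simps)

lemma of_nat_power_CHAR:
  assumes p: "prime p" "CHAR('a::comm_ring_1) = p"
  shows "(of_nat k :: 'a) ^ p = of_nat k"
proof (induction k)
  case 0
  then show ?case using prime_gt_0_nat[OF p(1)] by (simp add: power_0_left)
next
  case (Suc k)
  have "(1 + of_nat k :: 'a) ^ p = 1 ^ p + of_nat k ^ p"
    by (rule freshmans_dream) (simp_all add: p)
  then show ?case using Suc by simp
qed

lemma branch_eq:
  fixes \<theta> :: "'a::comm_ring_1"
  assumes p: "prime p" "CHAR('a) = p" and \<theta>: "\<theta> ^ p = \<theta>"
  shows "branch p \<theta> = branch p \<theta> ^ p + fps_X * branch p \<theta> ^ 2"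
proof (rule fps_ext)
  fix k
  have p1: "p > 1" using p(1) prime_gt_1_nat by blast
  show "branch p \<theta> $ k = (branch p \<theta> ^ p + fps_X * branch p \<theta> ^ 2) $ k"
  proof (cases k)
    case 0
    then show ?thesis by (simp add: fps_power_CHAR_nth[OF p] \<theta>)
  next
    case (Suc l)
    have 1: "(branch p \<theta> ^ p) $ k
       = of_nat (if p dvd k then branch_coeff p (k div p) else 0) * \<theta> ^ Suc k"
    proof (cases "p dvd k")
      case True
      then obtain q where q: "k = p * q" by blast
      have "(\<theta> ^ Suc q) ^ p = \<theta> ^ Suc k"
        by (metis Suc_mult_less_cancel1 \<theta> mult.commute power_Suc power_mult power_mult_distrib q)
      then show ?thesis using True q p1
        by (simp only: fps_power_CHAR_nth[OF p] branch_def fps_nth_Abs_fps power_mult_distrib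
            of_nat_power_CHAR[OF p]) simp
    qed (simp add: fps_power_CHAR_nth[OF p])
    have 2: "(fps_X * branch p \<theta> ^ 2) $ k
       = of_nat (\<Sum>i<k. branch_coeff p i * branch_coeff p (k - 1 - i)) * \<theta> ^ Suc k"
    proof -
      have "(fps_X * branch p \<theta> ^ 2) $ k = (\<Sum>i\<le>l. branch p \<theta> $ i * branch p \<theta> $ (l - i))"
        unfolding Suc power2_eq_square
        by (simp only: fps_X_mult_nth fps_mult_nth[of "branch p \<theta>"] atLeast0AtMost) simp
      also have "\<dots> = (\<Sum>i\<le>l. of_nat (branch_coeff p i * branch_coeff p (l - i)) * \<theta> ^ Suc k)"
      proof (rule sum.cong)
        fix i assume "i \<in> {..l}"
        then have "Suc k = Suc i + Suc (l - i)" using Suc by simp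
        then show "branch p \<theta> $ i * branch p \<theta> $ (l - i)
          = of_nat (branch_coeff p i * branch_coeff p (l - i)) * \<theta> ^ Suc k"
          by (simp only: branch_def fps_nth_Abs_fps power_add of_nat_mult) (simp add: ac_simps)
      qed simp
      finally show ?thesis by (simp add: Suc sum_distrib_right lessThan_Suc_atMost)
    qed
    have "branch p \<theta> $ k = of_nat (branch_coeff p k) * \<theta> ^ Suc k" by (simp add: branch_def)
    also have "\<dots> = (branch p \<theta> ^ p) $ k + (fps_X * branch p \<theta> ^ 2) $ k"
      unfolding 1 2 by (subst branch_coeff.simps) (use p1 Suc in \<open>simp add: algebra_simps\<close>)
    finally show ?thesis by simp
  qed
qed

section \<open>Sections of a power series along residue classes of exponents\<close>

definition fps_section :: "nat \<Rightarrow> nat \<Rightarrow> 'a::zero fps \<Rightarrow> 'a fps" where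
  "fps_section p r h = Abs_fps (\<lambda>m. h $ (p * m + r))"

lemma fps_section_nth [simp]: "fps_section p r h $ m = h $ (p * m + r)"
  by (simp add: fps_section_def)

lemma fps_section_sum: "fps_section p r (sum f A) = (\<Sum>i\<in>A. fps_section p r (f i))"
  by (rule fps_ext) (simp add: fps_sum_nth)

lemma fps_section_diff:
  "fps_section p r (g - h) = fps_section p r g - fps_section p r (h :: 'a::ab_group_add fps)"
  by (rule fps_ext) simp

lemma fps_section_of_nat_mult:
  "fps_section p r (of_nat k * h) = of_nat k * fps_section p r (h :: 'a::comm_ring_1 fps)"
  by (rule fps_ext) (simp add: fps_of_nat[symmetric] fps_mult_left_const_nth del: fps_of_nat)

lemma fps_section_X_mult:
  "fps_section p (Suc r) (fps_X * h) = fps_section p r (h :: 'a::comm_ring_1 fps)"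
  by (rule fps_ext) simp

text \<open>Since Frobenius fixes the coefficients, A^p = A(X^p) has only exponents divisible by p.
  Multiplication by it respects residue classes and comes out of the section as A.\<close>

lemma fps_section_power_mult:
  fixes A B :: "'a::comm_ring_1 fps"
  assumes p: "prime p" "CHAR('a) = p" and A: "\<And>k. (A $ k) ^ p = A $ k" and r: "r < p"
  shows "fps_section p r (A ^ p * B) = A * fps_section p r B"
proof (rule fps_ext)
  fix m
  have p0: "p > 0" using r by simp
  have "(A ^ p * B) $ (p * m + r)
      = (\<Sum>i\<le>p * m + r. (if p dvd i then A $ (i div p) else 0) * B $ (p * m + r - i))"
    by (simp add: fps_mult_nth fps_power_CHAR_nth[OF p] A atLeast0AtMost if_distrib cong: if_cong)
  also have "\<dots> = (\<Sum>i\<in>(\<lambda>l. p * l) ` {..m}. (if p dvd i then A $ (i div p) else 0) * B $ (p * m + r - i))"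
  proof (rule sum.mono_neutral_right)
    show "(\<lambda>l. p * l) ` {..m} \<subseteq> {..p * m + r}" by (auto intro: trans_le_add1)
    show "\<forall>i\<in>{..p * m + r} - (\<lambda>l. p * l) ` {..m}.
       (if p dvd i then A $ (i div p) else 0) * B $ (p * m + r - i) = 0"
    proof
      fix i assume i: "i \<in> {..p * m + r} - (\<lambda>l. p * l) ` {..m}"
      have "\<not> p dvd i"
      proof
        assume "p dvd i"
        then obtain l where l: "i = p * l" by blast
        then have "l > m" using i by auto
        then have "p * l \<ge> p * m + p" by (metis Suc_leI mult_Suc_right add.commute mult_le_mono2)
        then show False using i l r by simp
      qed
      then show "(if p dvd i then A $ (i div p) else 0) * B $ (p * m + r - i) = 0" by simp
    qed
  qed simp
  also have "\<dots> = (\<Sum>l\<le>m. A $ l * B $ (p * (m - l) + r))"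
  proof (subst sum.reindex)
    show "inj_on ((*) p) {..m}" using p0 by (auto simp: inj_on_def)
    show "sum ((\<lambda>i. (if p dvd i then A $ (i div p) else 0) * B $ (p * m + r - i)) \<circ> (*) p) {..m}
      = (\<Sum>l\<le>m. A $ l * B $ (p * (m - l) + r))"
    proof (rule sum.cong)
      fix l assume "l \<in> {..m}"
      then have "p * m + r - p * l = p * (m - l) + r"
        by (simp add: right_diff_distrib' )
      then show "((\<lambda>i. (if p dvd i then A $ (i div p) else 0) * B $ (p * m + r - i)) \<circ> (*) p) l
        = A $ l * B $ (p * (m - l) + r)" using p0 by simp
    qed simp
  qed
  finally show "fps_section p r (A ^ p * B) $ m = (A * fps_section p r B) $ m"
    by (simp add: fps_mult_nth atLeast0AtMost)
qed

text \<open>The section at residue 0 of A^p B^p = 1 is a second inverse of A, hence equals B; but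
  its coefficients are the \<open>p\<close>-th powers of those of B.\<close>

lemma fps_power_CHAR_eqI:
  fixes A B :: "'a::field fps"
  assumes p: "prime p" "CHAR('a) = p" and AB: "A * B = 1" and A: "\<And>k. (A $ k) ^ p = A $ k"
  shows "(B $ k) ^ p = B $ k"
proof -
  have p0: "p > 0" using p(1) prime_gt_0_nat by blast
  have "A ^ p * B ^ p = 1" using AB by (metis power_mult_distrib power_one)
  then have 1: "A * fps_section p 0 (B ^ p) = 1"
    using fps_section_power_mult[OF p A p0, of "B ^ p"] p0
    by (auto simp: fps_eq_iff)
  have "fps_section p 0 (B ^ p) = B"
  proof -
    have "fps_section p 0 (B ^ p) = (B * A) * fps_section p 0 (B ^ p)" using AB by (simp add: mult.commute)
    also have "\<dots> = B" using 1 by (simp add: mult.assoc)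
    finally show ?thesis .
  qed
  then have "fps_section p 0 (B ^ p) $ k = B $ k" by simp
  then show ?thesis using p0 by (simp add: fps_power_CHAR_nth[OF p])
qed

section \<open>Binomial coefficients modulo p\<close>

lemma prime_dvd_choose_carry:
  assumes p: "prime (p::nat)" and "b < p" "a - b < p" "p \<le> a" "b \<le> a"
  shows "p dvd (a choose b)"
proof -
  have "fact b * fact (a - b) * (a choose b) = (fact a :: nat)"
    by (rule binomial_fact_lemma) fact
  moreover have "p dvd (fact a :: nat)" using p assms by (simp add: prime_dvd_fact_iff)
  moreover have "\<not> p dvd (fact b :: nat)" "\<not> p dvd (fact (a - b) :: nat)"
    using p assms by (simp_all add: prime_dvd_fact_iff)
  ultimately show ?thesis using p by (metis prime_dvd_mult_iff)
qed

text \<open>Modulo p the number (p - 1)/2 is -1/2, and the binomial series of (1 - 4 w)^(-1/2) has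
  the central binomial coefficients. The bound \<open>r < p\<close> keeps the denominators of the
  induction invertible.\<close>

lemma half_binomial:
  fixes p :: nat
  assumes p: "CHAR('a::field) = p" "odd p" and r: "r < p"
  shows "(of_nat ((p - 1) div 2 choose r) * (-4) ^ r :: 'a) = of_nat (2 * r choose r)"
  using r
proof (induction r)
  case 0
  then show ?case by simp
next
  case (Suc r)
  define h where "h = (p - 1) div 2"
  have h: "p = 2 * h + 1" using p(2) unfolding h_def by (auto elim!: oddE)
  have nz: "(of_nat (Suc r) :: 'a) \<noteq> 0"
    unfolding of_nat_eq_0_iff_char_dvd p(1) using Suc.prems by (metis nat_dvd_not_less zero_less_Suc)
  have hz: "(2 * of_nat h + 1 :: 'a) = 0"
  proof -
    have "(of_nat p :: 'a) = 0" using p(1) of_nat_CHAR by metis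
    then show ?thesis by (simp add: h add.commute)
  qed
  have e1: "of_nat (Suc r) * (of_nat (h choose Suc r) :: 'a) = (of_nat h - of_nat r) * of_nat (h choose r)"
  proof (cases "r \<le> h")
    case True
    have "Suc r * (h choose Suc r) = (h - r) * (h choose r)"
      by (metis binomial_absorb_comp mult.commute binomial_absorption )
    then have "of_nat (Suc r * (h choose Suc r)) = (of_nat ((h - r) * (h choose r)) :: 'a)" by simp
    then show ?thesis using True by (simp only: of_nat_mult of_nat_diff)
  next
    case False
    then show ?thesis by (simp add: binomial_eq_0)
  qed
  have e2: "Suc r * (2 * Suc r choose Suc r) = (4 * r + 2) * (2 * r choose r)"
  proof -
    have "Suc r * (2 * Suc r choose Suc r) = 2 * Suc r * (Suc (2 * r) choose r)"
      using Suc_times_binomial[of r "Suc (2 * r)"] by simp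
    also have "\<dots> = 2 * (Suc r * (Suc (2 * r) choose Suc r))"
      using binomial_symmetric[of r "Suc (2 * r)"] by (simp add: Suc_diff_le)
    also have "\<dots> = 2 * (Suc (2 * r) * (2 * r choose r))"
      by (simp only: Suc_times_binomial)
    finally show ?thesis by simp
  qed
  have "of_nat (Suc r) * (of_nat (h choose Suc r) * (-4) ^ Suc r :: 'a)
     = -4 * (-4) ^ r * (of_nat (Suc r) * of_nat (h choose Suc r))"
    by (simp only: power_Suc mult_ac)
  also have "\<dots> = (-4 * (of_nat h - of_nat r)) * (of_nat (h choose r) * (-4) ^ r)"
    unfolding e1 by (simp only: mult_ac)
  also have "\<dots> = (-4 * (of_nat h - of_nat r)) * of_nat (2 * r choose r)"
    using Suc.IH Suc.prems unfolding h_def by simp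
  also have "(-4 * (of_nat h - of_nat r) :: 'a) = of_nat (4 * r + 2)"
  proof -
    have "(-4 * (of_nat h - of_nat r) :: 'a) = -2 * (2 * of_nat h + 1) + of_nat (4 * r + 2)"
      by (simp add: algebra_simps)
    then show ?thesis by (simp add: hz)
  qed
  also have "\<dots> * of_nat (2 * r choose r) = (of_nat (Suc r) * of_nat (2 * Suc r choose Suc r) :: 'a)"
    by (simp only: e2 flip: of_nat_mult)
  finally show ?case unfolding h_def mult_left_cancel[OF nz] .
qed

section \<open>The coefficients of the branch modulo p\<close>

locale branch_series =
  fixes p :: nat and f u :: "'a::field fps"
  assumes prime: "prime p" and CHAR: "CHAR('a) = p" and p7: "7 \<le> p"
  defines "f \<equiv> branch p 1"
  defines "u \<equiv> 1 - 2 * fps_X * f"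
begin

lemma odd_p: "odd p"
  using prime p7 prime_odd_nat by force

lemma of_nat_eq_0_iff: "(of_nat k :: 'a) = 0 \<longleftrightarrow> p dvd k"
  by (simp add: of_nat_eq_0_iff_char_dvd CHAR)

lemma of_nat_nonzero: "0 < k \<Longrightarrow> k < p \<Longrightarrow> (of_nat k :: 'a) \<noteq> 0"
  unfolding of_nat_eq_0_iff using nat_dvd_not_less by blast

lemma two_nonzero: "(2 :: 'a) \<noteq> 0"
  using of_nat_nonzero[of 2] p7 by simp

lemma f_eq: "f = f ^ p + fps_X * f ^ 2"
  unfolding f_def by (rule branch_eq[OF prime CHAR]) simp

lemma f_nth: "f $ k = of_nat (branch_coeff p k)"
  by (simp add: f_def branch_def)

text \<open>\<open>u\<close> is a square root of the discriminant of X Y^2 - Y + f^p, the quadratic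
  equation in Y that \<open>f\<close> satisfies.\<close>

lemma u_square: "u ^ 2 = 1 - 4 * fps_X * f ^ p"
proof -
  have "u ^ 2 = 1 - 4 * fps_X * (f - fps_X * f ^ 2)"
    unfolding u_def by (simp add: power2_eq_square algebra_simps)
  also have "f - fps_X * f ^ 2 = f ^ p" using f_eq by (metis add_diff_cancel_right')
  finally show ?thesis .
qed

lemma u_inverse: "u * inverse u = 1"
  by (rule inverse_mult_eq_1') (simp add: u_def)

lemma power_p_fixed:
  shows "(f $ k) ^ p = f $ k" "(u $ k) ^ p = u $ k" "(inverse u $ k) ^ p = inverse u $ k"
proof -
  show 1: "(f $ k) ^ p = f $ k" for k
    unfolding f_nth by (rule of_nat_power_CHAR[OF prime CHAR])
  have even: "(- c) ^ p = - (c ^ p)" for c :: 'a using odd_p by simp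
  have u: "(u $ k) ^ p = u $ k" for k
  proof (cases k)
    case 0
    then show ?thesis by (simp add: u_def)
  next
    case (Suc l)
    have "u $ k = - (2 * f $ l)" by (simp add: u_def Suc mult.assoc numeral_fps_const)
    moreover have "(2 * f $ l) ^ p = 2 * f $ l"
      using of_nat_power_CHAR[OF prime CHAR, of 2] by (simp add: power_mult_distrib 1)
    ultimately show ?thesis using even by simp
  qed
  then show "(u $ k) ^ p = u $ k" .
  show "(inverse u $ k) ^ p = inverse u $ k"
    by (rule fps_power_CHAR_eqI[OF prime CHAR u_inverse u])
qed

lemma section_f: "r < p \<Longrightarrow> fps_section p r (f ^ p * B) = f * fps_section p r B"
  and section_inverse_u: "r < p \<Longrightarrow> fps_section p r (inverse u ^ p * B) = inverse u * fps_section p r B"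
  using fps_section_power_mult[OF prime CHAR] power_p_fixed by blast+

lemma section_f_power: "r < p \<Longrightarrow> fps_section p r ((f ^ p) ^ j * B) = f ^ j * fps_section p r B"
  by (induction j) (simp_all add: section_f mult.assoc)

text \<open>As p is odd, 1/u = u^(-p) (u^2)^((p-1)/2), and \<open>u_square\<close> makes the second
  factor a finite binomial sum. Apart from \<open>p\<close>-th powers only X^i with i < p remain,
  which is the shape that sections can handle.\<close>

lemma inverse_u_expansion:
  "inverse u = (\<Sum>i\<le>(p - 1) div 2. fps_const (of_nat ((p - 1) div 2 choose i) * (-4) ^ i) *
      (inverse u ^ p * ((f ^ p) ^ i * fps_X ^ i)))"
proof -
  define h where "h = (p - 1) div 2"
  have h: "p = Suc (2 * h)" using odd_p unfolding h_def by (auto elim!: oddE)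
  have "inverse u = inverse u * (u * inverse u) ^ (2 * h)" by (simp add: u_inverse)
  also have "\<dots> = inverse u ^ p * (u ^ 2) ^ h"
    by (subst h) (simp add: power_mult_distrib power_mult)
  also have "u ^ 2 = - 4 * (f ^ p * fps_X) + 1" unfolding u_square by simp
  also have "(- 4 * (f ^ p * fps_X) + 1) ^ h
      = (\<Sum>i\<le>h. of_nat (h choose i) * (- 4 * (f ^ p * fps_X)) ^ i)"
    by (subst binomial_ring) simp
  also have "\<dots> = (\<Sum>i\<le>h. fps_const (of_nat (h choose i) * (-4) ^ i) * ((f ^ p) ^ i * fps_X ^ i))"
  proof (rule sum.cong)
    fix i
    have "(-4 :: 'a fps) = fps_const (-4)" by (simp add: numeral_fps_const)
    then have "(- 4 * (f ^ p * fps_X)) ^ i = fps_const ((-4) ^ i) * ((f ^ p) ^ i * fps_X ^ i)"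
      by (simp only: power_mult_distrib fps_const_power)
    then show "of_nat (h choose i) * (- 4 * (f ^ p * fps_X)) ^ i
      = fps_const (of_nat (h choose i) * (-4) ^ i) * ((f ^ p) ^ i * fps_X ^ i)"
      by (simp only: fps_of_nat[symmetric] fps_const_mult[symmetric] mult.assoc)
  qed simp
  finally show ?thesis unfolding h_def by (simp add: sum_distrib_left mult.left_commute)
qed

lemma section_const_mult:
  "fps_section p r (fps_const c * h) = fps_const c * fps_section p r (h :: 'a fps)"
  by (rule fps_ext) simp

lemma section_X_power:
  "r < p \<Longrightarrow> i < p \<Longrightarrow> fps_section p r (fps_X ^ i :: 'a fps) = (if i = r then 1 else 0)"
proof (rule fps_ext)
  fix m
  assume *: "r < p" "i < p"
  have "p * m + r = i \<longleftrightarrow> m = 0 \<and> i = r"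
    using * by (metis add.left_neutral mod_less mod_mult_self4 mult_0_right mult_eq_self_implies_10
        add_eq_self_zero div_mult_self4 div_less nat_neq_iff less_nat_zero_code add.commute not_gr_zero)
  then show "fps_section p r (fps_X ^ i :: 'a fps) $ m = (if i = r then 1 else 0) $ m"
    by (auto simp: fps_X_power_nth)
qed

text \<open>All powers of X in the expansion are below p, so only the term \<open>i = r\<close>
  survives. For r above (p - 1)/2 both sides are zero.\<close>

lemma section_inverse_u_eq:
  assumes r: "r < p"
  shows "fps_section p r (inverse u) = of_nat (2 * r choose r) * (f ^ r * inverse u)"
proof -
  define h where "h = (p - 1) div 2"
  have h: "h < p" unfolding h_def using p7 by simp
  have "fps_section p r (inverse u) = (\<Sum>i\<le>h. fps_const (of_nat (h choose i) * (-4) ^ i) *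
      (inverse u * (f ^ i * (if i = r then 1 else 0))))"
    by (subst inverse_u_expansion, unfold fps_section_sum h_def[symmetric])
      (use r h in \<open>simp add: section_const_mult section_inverse_u section_f_power section_X_power\<close>)
  also have "\<dots> = (\<Sum>i\<le>h. if i = r then fps_const (of_nat (h choose r) * (-4) ^ r) * (f ^ r * inverse u) else 0)"
    by (rule sum.cong) (auto simp: mult_ac)
  also have "\<dots> = fps_const (of_nat (h choose r) * (-4) ^ r) * (f ^ r * inverse u)"
    by (simp add: binomial_eq_0)
  finally show ?thesis using half_binomial[OF CHAR odd_p r] unfolding h_def
    by (simp add: fps_of_nat)
qed

text \<open>The coefficients are those of \<open>C(w)\<^sup>j / sqrt (1 - 4 w)\<close> at \<open>w = X f\<^sup>p\<close>, where \<open>C\<close> is the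
  Catalan series. Modulo \<open>p\<close> they depend only on the residue class of the exponent as long as no
  carry occurs.\<close>

lemma section_eq:
  assumes "r + j < p"
  shows "fps_section p r (f ^ j * inverse u) = of_nat (2 * r + j choose r) * (f ^ (r + j) * inverse u)"
  using assms
proof (induction j arbitrary: r rule: less_induct)
  case (less j)
  consider "j = 0" | "j = 1" | i where "j = Suc (Suc i)"
    by (metis One_nat_def not0_implies_Suc)
  then show ?case
  proof cases
    case 1
    then show ?thesis using section_inverse_u_eq less.prems by simp
  next
    case 2
    \<comment> \<open>The factor X shifts residues by one, so section r of f/u is read off from
      section r + 1 of 1/u, to which the constant 1 contributes nothing.\<close>
    have "2 * (fps_X * (f * inverse u)) = (1 - u) * inverse u" by (simp add: u_def mult_ac)
    also have "\<dots> = inverse u - 1" by (simp add: algebra_simps u_inverse)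
    finally have e: "of_nat 2 * (fps_X * (f * inverse u)) = inverse u - 1" by simp
    have "of_nat 2 * fps_section p r (f * inverse u)
        = fps_section p (Suc r) (of_nat 2 * (fps_X * (f * inverse u)))"
      by (rule sym, subst fps_section_of_nat_mult, subst fps_section_X_mult, rule refl)
    also have "\<dots> = fps_section p (Suc r) (inverse u) - fps_section p (Suc r) (fps_X ^ 0)"
      by (simp only: e fps_section_diff power_0)
    also have "\<dots> = of_nat (2 * Suc r choose Suc r) * (f ^ Suc r * inverse u)"
      using less.prems 2 by (simp only: section_X_power) (simp add: section_inverse_u_eq)
    also have "(2 * Suc r choose Suc r) = 2 * (2 * r + 1 choose r)"
      using binomial_symmetric[of "Suc r" "Suc (2 * r)"] by simp
    finally have "of_nat 2 * fps_section p r (f * inverse u)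
        = of_nat 2 * (of_nat (2 * r + 1 choose r) * (f ^ Suc r * inverse u))"
      by (simp only: of_nat_mult mult.assoc)
    moreover have "(of_nat 2 :: 'a fps) \<noteq> 0"
      by (metis two_nonzero fps_numeral_nth_0 fps_zero_nth of_nat_numeral)
    ultimately have "fps_section p r (f * inverse u) = of_nat (2 * r + 1 choose r) * (f ^ Suc r * inverse u)"
      by (metis mult_left_cancel)
    then show ?thesis using 2 by simp
  next
    case (3 i)
    \<comment> \<open>The functional equation lowers the power of f while the shift by X raises r.
      The sum r + j does not grow, so the no-carry bound persists, and Pascal's rule combines the
      two binomial coefficients.\<close>
    have e: "fps_X * (f ^ Suc (Suc i) * inverse u) = f ^ Suc i * inverse u - f ^ p * (f ^ i * inverse u)"
    proof -
      have "fps_X * f ^ 2 = f - f ^ p" using f_eq by (metis add_diff_cancel_left')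
      then have "fps_X * f ^ 2 * (f ^ i * inverse u) = (f - f ^ p) * (f ^ i * inverse u)" by simp
      then show ?thesis by (simp add: algebra_simps power2_eq_square)
    qed
    have "fps_section p r (f ^ Suc (Suc i) * inverse u)
       = fps_section p (Suc r) (fps_X * (f ^ Suc (Suc i) * inverse u))"
      by (rule fps_section_X_mult[symmetric])
    also have "\<dots> = fps_section p (Suc r) (f ^ Suc i * inverse u) - f * fps_section p (Suc r) (f ^ i * inverse u)"
      unfolding e fps_section_diff using less.prems 3 by (subst section_f) simp_all
    also have "\<dots> = of_nat (2 * Suc r + Suc i choose Suc r) * (f ^ (Suc r + Suc i) * inverse u)
        - f * (of_nat (2 * Suc r + i choose Suc r) * (f ^ (Suc r + i) * inverse u))"
      using less.IH[of "Suc i" "Suc r"] less.IH[of i "Suc r"] less.prems 3 by simp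
    also have "(2 * Suc r + Suc i choose Suc r) = (2 * Suc r + i choose r) + (2 * Suc r + i choose Suc r)"
      by simp
    finally show ?thesis using 3 by (simp add: algebra_simps)
  qed
qed

lemma exists_nonzero_coeff:
  assumes "1 \<le> j" "j \<le> p - 2"
  shows "\<exists>M. (p - 1) dvd (M + j + 1) \<and> (f ^ j * inverse u) $ M \<noteq> 0"
  using assms(2,1)
proof (induction rule: inc_induct)
  case base
  have "p - 2 + 1 = p - 1" using p7 by simp
  moreover have "(f ^ (p - 2) * inverse u) $ 0 \<noteq> 0"
    by (simp add: fps_nth_power_0 f_nth u_def branch_coeff.simps)
  ultimately show ?case by (intro exI[of _ 0]) auto
next
  case (step j)
  then obtain M where M: "(p - 1) dvd (M + Suc j + 1)" "(f ^ Suc j * inverse u) $ M \<noteq> 0" by auto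
  have "fps_section p 1 (f ^ j * inverse u) = of_nat (j + 2) * (f ^ Suc j * inverse u)"
    using section_eq[of 1 j] step.hyps p7 by simp
  then have "fps_section p 1 (f ^ j * inverse u) $ M = of_nat (j + 2) * (f ^ Suc j * inverse u) $ M"
    by (simp only: fps_of_nat[symmetric] fps_mult_left_const_nth)
  then have "(f ^ j * inverse u) $ (p * M + 1) = of_nat (j + 2) * (f ^ Suc j * inverse u) $ M"
    by (simp only: fps_section_nth)
  moreover have "(of_nat (j + 2) :: 'a) \<noteq> 0" using step.hyps p7 by (intro of_nat_nonzero) auto
  ultimately have "(f ^ j * inverse u) $ (p * M + 1) \<noteq> 0" using M by simp
  moreover have "p * M + 1 + j + 1 = (p - 1) * M + (M + Suc j + 1)"
    using p7 by (cases p) auto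
  moreover have "(p - 1) dvd (p - 1) * M + (M + Suc j + 1)"
    using M(1) by (rule dvd_add[OF dvd_triv_left])
  ultimately show ?case by (intro exI[of _ "p * M + 1"] conjI) (simp_all only: not_False_eq_True)
qed

text \<open>The derivative of f^p is zero, so differentiating the functional equation gives u f' =
  f^2. This links the branch coefficients to f^2/u, whose sections are known.\<close>

lemma deriv_f: "fps_deriv f = f ^ 2 * inverse u"
proof -
  have "fps_deriv (f ^ p) = 0"
    using of_nat_CHAR[where 'a='a] by (simp add: fps_deriv_power CHAR)
  then have "fps_deriv f = f ^ 2 + fps_X * (2 * f * fps_deriv f)"
    by (subst f_eq) (simp add: power2_eq_square algebra_simps)
  then have "u * fps_deriv f = f ^ 2" by (simp add: u_def algebra_simps)
  then have "inverse u * u * fps_deriv f = inverse u * f ^ 2" by (simp add: mult.assoc)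
  then show ?thesis by (simp add: mult.commute u_inverse)
qed

lemma Suc_branch_coeff: "(f ^ 2 * inverse u) $ k = of_nat (Suc k) * of_nat (branch_coeff p (Suc k))"
  by (simp add: deriv_f[symmetric] f_nth)

lemma exists_branch_coeff_nonzero:
  "\<exists>k. (p - 1) dvd (k + 2) \<and> of_nat (branch_coeff p k) \<noteq> (0 :: 'a)"
proof -
  have "2 \<le> p - 2" using p7 by simp
  then obtain M where "(p - 1) dvd (M + 2 + 1)" "(f ^ 2 * inverse u) $ M \<noteq> 0"
    using exists_nonzero_coeff[of 2, OF one_le_numeral] by blast
  then show ?thesis by (intro exI[of _ "Suc M"]) (auto simp: Suc_branch_coeff)
qed

text \<open>Coefficient p - 4 of f^2/u is (p - 3) times the coefficient in question. It also equals
  the binomial coefficient of 2p - 6 over p - 4, and adding p - 4 and p - 2 in base p produces a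
  carry because 2p - 6 is at least p.\<close>

lemma branch_coeff_p_minus_3: "of_nat (branch_coeff p (p - 3)) = (0 :: 'a)"
proof -
  have "fps_section p (p - 4) (f ^ 2 * inverse u) $ 0
      = (of_nat (2 * (p - 4) + 2 choose (p - 4)) * (f ^ (p - 4 + 2) * inverse u)) $ 0"
    using p7 by (subst section_eq) auto
  also have "\<dots> = 0"
  proof -
    have "p dvd (2 * (p - 4) + 2 choose (p - 4))"
      using p7 by (intro prime_dvd_choose_carry prime) auto
    then have "(of_nat (2 * (p - 4) + 2 choose (p - 4)) :: 'a) = 0" by (simp only: of_nat_eq_0_iff)
    then show ?thesis by (simp only: fps_of_nat[symmetric] fps_mult_left_const_nth) simp
  qed
  finally have "of_nat (Suc (p - 4)) * of_nat (branch_coeff p (Suc (p - 4))) = (0 :: 'a)"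
    by (simp add: Suc_branch_coeff)
  moreover have "Suc (p - 4) = p - 3" using p7 by simp
  moreover have "(of_nat (p - 3) :: 'a) \<noteq> 0" using p7 by (intro of_nat_nonzero) auto
  ultimately show ?thesis by (metis mult_eq_0_iff)
qed

lemma branch_coeff_small:
  assumes "j \<in> {1, 2, 3}"
  shows "of_nat (branch_coeff p j) \<noteq> (0 :: 'a)"
proof -
  have nd: "\<not> p dvd 1" "\<not> p dvd 2" "\<not> p dvd 3"
    using p7 by (auto dest!: dvd_imp_le)
  have 0: "branch_coeff p 0 = 1" by (simp add: branch_coeff.simps)
  have 1: "branch_coeff p 1 = 1" by (subst branch_coeff.simps) (use nd in \<open>simp add: 0\<close>)
  have 2: "branch_coeff p 2 = 2"
    by (subst branch_coeff.simps) (use nd 1 in \<open>simp add: 0 numeral_2_eq_2\<close>)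
  have 3: "branch_coeff p 3 = 5"
    by (subst branch_coeff.simps) (use nd 1 2 in \<open>simp add: 0 numeral_3_eq_3 numeral_2_eq_2\<close>)
  show ?thesis using assms of_nat_nonzero[of 1] of_nat_nonzero[of 2] of_nat_nonzero[of 5] p7 1 2 3
    by auto
qed

end

section \<open>Newton's identities\<close>

text \<open>Logarithmic derivative: each factor contributes -x/(1 - x X), a geometric series, and
  these add up to the generating series of the power sums.\<close>

lemma fps_deriv_prod_linear:
  fixes x :: "'i \<Rightarrow> 'b::comm_ring_1"
  assumes "finite A"
  shows "fps_deriv (\<Prod>i\<in>A. 1 - fps_const (x i) * fps_X)
    = - (\<Prod>i\<in>A. 1 - fps_const (x i) * fps_X) * Abs_fps (\<lambda>k. \<Sum>i\<in>A. x i ^ Suc k)"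
  using assms
proof (induction A rule: finite_induct)
  case empty
  show ?case by (simp add: fps_eq_iff)
next
  case (insert j A)
  define R where "R = (\<Prod>i\<in>A. 1 - fps_const (x i) * fps_X)"
  define S where "S = Abs_fps (\<lambda>k. \<Sum>i\<in>A. x i ^ Suc k)"
  define g where "g = Abs_fps (\<lambda>k. x j ^ Suc k)"
  have g: "(1 - fps_const (x j) * fps_X) * g = fps_const (x j)"
  proof (rule fps_ext)
    fix k show "((1 - fps_const (x j) * fps_X) * g) $ k = fps_const (x j) $ k"
      by (cases k) (simp_all add: g_def left_diff_distrib mult.assoc)
  qed
  have S: "Abs_fps (\<lambda>k. \<Sum>i\<in>insert j A. x i ^ Suc k) = g + S"
    using insert.hyps by (simp add: fps_eq_iff g_def S_def)
  have "fps_deriv ((1 - fps_const (x j) * fps_X) * R)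
     = - fps_const (x j) * R + (1 - fps_const (x j) * fps_X) * (- R * S)"
    using insert.IH unfolding R_def[symmetric] S_def[symmetric] by (simp add: mult.commute)
  also have "\<dots> = - ((1 - fps_const (x j) * fps_X) * g) * R + (1 - fps_const (x j) * fps_X) * (- R * S)"
    by (simp only: g)
  also have "\<dots> = - ((1 - fps_const (x j) * fps_X) * R) * (g + S)"
    by (simp add: algebra_simps)
  finally have "fps_deriv ((1 - fps_const (x j) * fps_X) * R)
    = - ((1 - fps_const (x j) * fps_X) * R) * (g + S)" .
  moreover have "(\<Prod>i\<in>insert j A. 1 - fps_const (x i) * fps_X) = (1 - fps_const (x j) * fps_X) * R"
    using insert.hyps by (simp add: R_def)
  ultimately show ?case unfolding S by metis
qed

lemma degree_prod_linear: "degree (\<Prod>i\<in>A. [:- x i, 1 :: 'b::idom:]) = card A"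
  by (subst degree_prod_eq_sum_degree) simp_all

text \<open>Reversing \<open>Q\<close> gives the product of the 1 - x_i X; compare coefficients in
  the formula for its derivative.\<close>

lemma newton_recurrence:
  fixes x :: "nat \<Rightarrow> 'b::idom"
  assumes k: "k < n"
  defines "Q \<equiv> (\<Prod>i\<in>{1..n}. [:- x i, 1:])"
  shows "of_nat (Suc k) * coeff Q (n - Suc k)
    = - (\<Sum>i\<le>k. coeff Q (n - i) * (\<Sum>j\<in>{1..n}. x j ^ Suc (k - i)))"
proof -
  define R where "R = (\<Prod>i\<in>{1..n}. 1 - fps_const (x i) * fps_X)"
  have refl: "reflect_poly [:- x i, 1:] = [:1, - x i:]" for i
    by (simp add: poly_eq_iff reflect_poly_def)
  have lin: "fps_of_poly [:1, - x i:] = 1 - fps_const (x i) * fps_X" for i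
    by (rule fps_ext) (auto simp: coeff_pCons split: nat.splits)
  have "fps_of_poly (reflect_poly Q) = R"
    unfolding Q_def R_def reflect_poly_prod fps_of_poly_prod refl lin ..
  then have R: "R $ i = coeff Q (n - i)" if "i \<le> n" for i
    using that degree_prod_linear[of x "{1..n}"] by (auto simp: coeff_reflect_poly Q_def)
  have "fps_deriv R = - R * Abs_fps (\<lambda>k. \<Sum>i\<in>{1..n}. x i ^ Suc k)"
    unfolding R_def by (rule fps_deriv_prod_linear) simp
  then have "fps_deriv R $ k = (- R * Abs_fps (\<lambda>k. \<Sum>i\<in>{1..n}. x i ^ Suc k)) $ k" by simp
  then have "of_nat (Suc k) * R $ Suc k = - (\<Sum>i\<le>k. R $ i * (\<Sum>j\<in>{1..n}. x j ^ Suc (k - i)))"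
    by (simp add: fps_mult_nth atLeast0AtMost sum_negf)
  also have "(\<Sum>i\<le>k. R $ i * (\<Sum>j\<in>{1..n}. x j ^ Suc (k - i)))
    = (\<Sum>i\<le>k. coeff Q (n - i) * (\<Sum>j\<in>{1..n}. x j ^ Suc (k - i)))"
    using k by (intro sum.cong) (simp_all add: R)
  finally show ?thesis using k by (simp add: R)
qed

text \<open>Stated for domains rather than fields because it is instantiated twice: for the ground
  field and for its power series ring, where the branches live.\<close>

locale prime_char =
  fixes p :: nat and ty :: "'b::idom itself"
  assumes prime: "prime p" and CHAR: "CHAR('b) = p" and p7: "7 \<le> p"
begin

lemma of_nat_nonzero: "0 < k \<Longrightarrow> k < p \<Longrightarrow> (of_nat k :: 'b) \<noteq> 0"
  unfolding of_nat_eq_0_iff_char_dvd CHAR using nat_dvd_not_less by blast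

lemma of_nat_p [simp]: "(of_nat p :: 'b) = 0"
  by (metis CHAR of_nat_CHAR)

lemma of_nat_p_minus: "k \<le> p \<Longrightarrow> (of_nat (p - k) :: 'b) = - of_nat k"
  by (simp add: of_nat_diff)

text \<open>The middle coefficients vanish, so Newton's recurrence collapses to a single term. The
  factors 2 and 1 are -(p - 2) and -(p - 1) in characteristic p.\<close>

lemma power_sums_trinomial:
  assumes Q: "(\<Prod>i\<in>{1..p - 1}. [:- x i, 1:]) = monom 1 (p - 1) + [:b, a :: 'b:]"
  shows "k \<in> {1..p - 3} \<Longrightarrow> (\<Sum>i\<in>{1..p - 1}. x i ^ k) = 0"
    and "(\<Sum>i\<in>{1..p - 1}. x i ^ (p - 2)) = 2 * a"
    and "(\<Sum>i\<in>{1..p - 1}. x i ^ (p - 1)) = b"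
proof -
  note One_nat_def [simp del]
  define c where "c = coeff (monom 1 (p - 1) + [:b, a :: 'b:])"
  define s where "s k = (\<Sum>i\<in>{1..p - 1}. x i ^ k)" for k
  have c: "c (p - 1) = 1" "c 0 = b" "c 1 = a" "\<And>k. k \<in> {2..p - 2} \<Longrightarrow> c k = 0"
    using p7 by (auto simp: c_def coeff_pCons split: nat.splits)
  have rec: "of_nat (Suc k) * c (p - 1 - Suc k) = - (\<Sum>i\<le>k. c (p - 1 - i) * s (Suc (k - i)))"
    if "k < p - 1" for k
    using newton_recurrence[OF that, of x] unfolding Q c_def s_def .
  have z: "c (p - 1 - i) = 0" if "i \<in> {1..p - 3}" for i
    using that p7 by (intro c(4)) auto
  have s1: "s (Suc k) = - (of_nat (Suc k) * c (p - 1 - Suc k))" if "k \<le> p - 3" for k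
  proof -
    have "(\<Sum>i\<le>k. c (p - 1 - i) * s (Suc (k - i))) = (\<Sum>i\<in>{0}. c (p - 1 - i) * s (Suc (k - i)))"
    proof (rule sum.mono_neutral_right)
      show "\<forall>i\<in>{..k} - {0}. c (p - 1 - i) * s (Suc (k - i)) = 0"
      proof
        fix i assume "i \<in> {..k} - {0}"
        then have "c (p - 1 - i) = 0" using that by (intro z) auto
        then show "c (p - 1 - i) * s (Suc (k - i)) = 0" by simp
      qed
    qed auto
    then show ?thesis using rec[of k] that p7 by (simp add: c(1))
  qed
  show s0: "(\<Sum>i\<in>{1..p - 1}. x i ^ k) = 0" if "k \<in> {1..p - 3}" for k
  proof -
    have e: "Suc (k - 1) = k" using that by simp
    then have "s k = - (of_nat k * c (p - 1 - k))" using s1[of "k - 1"] that by (auto simp del: diff_diff_left)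
    then show ?thesis using z[OF that] by (simp add: s_def)
  qed
  show "(\<Sum>i\<in>{1..p - 1}. x i ^ (p - 2)) = 2 * a"
  proof -
    have e: "Suc (p - 3) = p - 2" "p - 1 - (p - 2) = 1" using p7 by auto
    have "s (p - 2) = - (of_nat (p - 2) * a)" using s1[of "p - 3"] unfolding e c(3) by simp
    then show ?thesis using p7 by (simp add: s_def of_nat_p_minus)
  qed
  show "(\<Sum>i\<in>{1..p - 1}. x i ^ (p - 1)) = b"
  proof -
    have e: "Suc (p - 2) = p - 1" using p7 by auto
    have "(\<Sum>i\<le>p - 2. c (p - 1 - i) * s (Suc (p - 2 - i))) = (\<Sum>i\<in>{0}. c (p - 1 - i) * s (Suc (p - 2 - i)))"
    proof (rule sum.mono_neutral_right)
      show "\<forall>i\<in>{..p - 2} - {0}. c (p - 1 - i) * s (Suc (p - 2 - i)) = 0"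
      proof
        fix i assume i: "i \<in> {..p - 2} - {0}"
        show "c (p - 1 - i) * s (Suc (p - 2 - i)) = 0"
        \<comment> \<open>Here the coefficient is \<open>a\<close>, possibly nonzero, but its
          partner is the first power sum, which is zero.\<close>
        proof (cases "i = p - 2")
          case True
          then show ?thesis using s0[of 1] p7 by (simp add: s_def)
        next
          case False
          then show ?thesis using i z[of i] by auto
        qed
      qed
    qed auto
    then have "of_nat (p - 1) * c 0 = - s (p - 1)" using rec[of "p - 2"] p7 e c by simp
    then show ?thesis using p7 c(2) by (simp add: s_def of_nat_p_minus)
  qed
qed

text \<open>Newton's recurrence determines coefficients from power sums as long as its factor
  \<open>Suc k\<close> is invertible, which holds below p.\<close>

lemma trinomial_of_power_sums:
  fixes x :: "nat \<Rightarrow> 'b"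
  assumes s: "\<And>k. k \<in> {1..p - 3} \<Longrightarrow> (\<Sum>i\<in>{1..p - 1}. x i ^ k) = 0"
  shows "\<exists>a b. (\<Prod>i\<in>{1..p - 1}. [:- x i, 1:]) = monom 1 (p - 1) + [:b, a:]"
proof -
  note One_nat_def [simp del]
  define Q where "Q = (\<Prod>i\<in>{1..p - 1}. [:- x i, 1:])"
  have deg: "degree Q = p - 1" using degree_prod_linear[of x "{1..p - 1}"] by (simp add: Q_def)
  have z: "coeff Q (p - 1 - Suc k) = 0" if k: "k < p - 3" for k
  proof -
    have "of_nat (Suc k) * coeff Q (p - 1 - Suc k) = - (\<Sum>i\<le>k. coeff Q (p - 1 - i) * (\<Sum>j\<in>{1..p - 1}. x j ^ Suc (k - i)))"
      unfolding Q_def using k by (intro newton_recurrence) auto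
    also have "\<dots> = 0"
    proof -
      have "(\<Sum>j\<in>{1..p - 1}. x j ^ Suc (k - i)) = 0" for i by (rule s) (use k in auto)
      then show ?thesis by (simp add: sum.neutral del: power_Suc)
    qed
    finally show ?thesis using of_nat_nonzero[of "Suc k"] k by simp
  qed
  have lead: "coeff Q (p - 1) = 1"
  proof -
    have "lead_coeff Q = 1" unfolding Q_def by (simp add: lead_coeff_prod)
    then show ?thesis by (simp add: deg)
  qed
  have "Q = monom 1 (p - 1) + [:coeff Q 0, coeff Q 1:]"
  proof (rule poly_eqI)
    fix k
    consider "k = 0" | "k = 1" | "k \<in> {2..p - 2}" | "k = p - 1" | "p - 1 < k" by force
    then show "coeff Q k = coeff (monom 1 (p - 1) + [:coeff Q 0, coeff Q 1:]) k"
    proof cases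
      case 3
      then have "coeff Q (p - 1 - Suc (p - 2 - k)) = 0" by (intro z) auto
      moreover have "p - 1 - Suc (p - 2 - k) = k" using 3 p7 by auto
      ultimately show ?thesis using 3 by (auto simp: coeff_pCons split: nat.splits)
    next
      case 5
      then show ?thesis using p7 deg by (auto simp: coeff_pCons coeff_eq_0 split: nat.splits)
    qed (use p7 lead in \<open>auto simp: coeff_pCons split: nat.splits\<close>)
  qed
  then show ?thesis unfolding Q_def by blast
qed

lemma trinomial_root:
  assumes Q: "(\<Prod>i\<in>{1..p - 1}. [:- x i, 1:]) = monom 1 (p - 1) + [:b, a :: 'b:]"
    and i: "i \<in> {1..p - 1}"
  shows "x i ^ (p - 1) + a * x i + b = 0"
proof -
  have "poly (\<Prod>i\<in>{1..p - 1}. [:- x i, 1:]) (x i) = 0"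
    using i by (auto simp: poly_prod intro!: prod_zero)
  then show ?thesis unfolding Q by (simp add: poly_monom algebra_simps)
qed

end

text \<open>Nonzero entries satisfy \<theta>^(p-1) = 1. If a were nonzero, the trinomial would be
  linear on them and they would all equal one z; then the first power sum is N z with 0 < N < p,
  which is nonzero. So a = 0, hence b = -1, and the trinomial T^(p-1) - 1 is separable.\<close>

lemma rational_tuple:
  fixes \<theta> :: "nat \<Rightarrow> 'a::field"
  assumes p: "prime p" "CHAR('a) = p" "7 \<le> p"
    and s: "\<And>k. k \<in> {1..p - 3} \<Longrightarrow> (\<Sum>i\<in>{1..p - 1}. \<theta> i ^ k) = 0"
    and fixed: "\<And>i. i \<in> {1..p - 1} \<Longrightarrow> \<theta> i ^ p = \<theta> i"
    and nz: "\<exists>i\<in>{1..p - 1}. \<theta> i \<noteq> 0"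
  shows "\<And>i. i \<in> {1..p - 1} \<Longrightarrow> \<theta> i ^ (p - 1) = 1" "inj_on \<theta> {1..p - 1}"
    "(\<Prod>i\<in>{1..p - 1}. [:- \<theta> i, 1:]) = monom 1 (p - 1) + [:-1, 0:]"
proof -
  note One_nat_def [simp del]
  interpret prime_char p "TYPE('a)" by unfold_locales (fact p)+
  obtain a b where Q: "(\<Prod>i\<in>{1..p - 1}. [:- \<theta> i, 1:]) = monom 1 (p - 1) + [:b, a:]"
    using trinomial_of_power_sums s by blast
  have one: "\<theta> i ^ (p - 1) = 1" if "i \<in> {1..p - 1}" "\<theta> i \<noteq> 0" for i
  proof -
    have e: "Suc (p - 1) = p" using p(3) by simp
    have "\<theta> i * \<theta> i ^ (p - 1) = \<theta> i * 1"
      by (simp only: power_Suc[symmetric] e fixed[OF that(1)] mult_1_right)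
    then show ?thesis using that(2) by (metis mult_left_cancel)
  qed
  have a0: "a = 0"
  proof (rule ccontr)
    assume a: "a \<noteq> 0"
    define z where "z = - (1 + b) / a"
    define N where "N = {i \<in> {1..p - 1}. \<theta> i \<noteq> 0}"
    have z: "\<theta> i = z" if "i \<in> N" for i
    proof -
      have "a * \<theta> i + (1 + b) = 0"
        using trinomial_root[OF Q, of i] one[of i] that by (simp add: N_def add_ac)
      then have "a * \<theta> i = - (1 + b)" by (rule eq_neg_iff_add_eq_0[THEN iffD2])
      then have "\<theta> i * a = - (1 + b)" by (simp only: mult.commute)
      then show ?thesis unfolding z_def nonzero_eq_divide_eq[OF a] .
    qed
    have "0 = (\<Sum>i\<in>{1..p - 1}. \<theta> i ^ 1)" by (rule s[symmetric]) (use p(3) in auto)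
    also have "\<dots> = (\<Sum>i\<in>N. \<theta> i)" by (simp only: power_one_right) (rule sum.mono_neutral_right, auto simp: N_def)
    also have "\<dots> = (\<Sum>i\<in>N. z)" by (rule sum.cong) (simp_all add: z)
    also have "\<dots> = of_nat (card N) * z" by simp
    finally have "of_nat (card N) * z = 0" by simp
    moreover have "0 < card N" unfolding N_def using nz by (subst card_gt_0_iff) auto
    moreover have "card N < p"
    proof -
      have "card N \<le> card {1..p - 1}" unfolding N_def by (rule card_mono) auto
      then show ?thesis using p(3) by simp
    qed
    moreover have "z \<noteq> 0"
    proof -
      obtain i where i: "i \<in> {1..p - 1}" "\<theta> i \<noteq> 0" using nz by blast
      then have "i \<in> N" by (simp add: N_def)
      then show ?thesis using z i(2) by metis
    qed
    ultimately show False using of_nat_nonzero[of "card N"] by simp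
  qed
  have b: "b = -1"
  proof -
    obtain i where i: "i \<in> {1..p - 1}" "\<theta> i \<noteq> 0" using nz by blast
    then have "1 + b = 0" using trinomial_root[OF Q i(1)] one[of i] a0 by simp
    then show ?thesis by (simp add: add_eq_0_iff)
  qed
  show Q': "(\<Prod>i\<in>{1..p - 1}. [:- \<theta> i, 1:]) = monom 1 (p - 1) + [:-1, 0:]"
    using Q a0 b by simp
  show 1: "\<theta> i ^ (p - 1) = 1" if "i \<in> {1..p - 1}" for i
    using trinomial_root[OF Q' that] by simp
  show "inj_on \<theta> {1..p - 1}"
  proof (rule inj_onI, rule ccontr)
    fix i j assume ij: "i \<in> {1..p - 1}" "j \<in> {1..p - 1}" "\<theta> i = \<theta> j" "i \<noteq> j"
    define R where "R = (\<Prod>i\<in>{1..p - 1} - {i} - {j}. [:- \<theta> i, 1:])"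
    have "(\<Prod>i\<in>{1..p - 1}. [:- \<theta> i, 1:]) = [:- \<theta> i, 1:] * (\<Prod>i\<in>{1..p - 1} - {i}. [:- \<theta> i, 1:])"
      by (rule prod.remove) (use ij in auto)
    also have "(\<Prod>i\<in>{1..p - 1} - {i}. [:- \<theta> i, 1:]) = [:- \<theta> j, 1:] * R"
      unfolding R_def by (rule prod.remove) (use ij in auto)
    finally have R: "monom 1 (p - 1) + [:-1, 0:] = [:- \<theta> i, 1:] * ([:- \<theta> i, 1:] * R)"
      unfolding Q' ij(3) .
    have "poly (pderiv (monom 1 (p - 1) + [:-1, 0:])) (\<theta> i) = 0"
      unfolding R by (simp only: pderiv_mult poly_mult poly_add) simp
    then have "of_nat (p - 1) * \<theta> i ^ (p - 2) = 0"
      by (simp add: pderiv_add pderiv_monom pderiv_pCons poly_monom numeral_2_eq_2)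
    moreover have "(of_nat (p - 1) :: 'a) \<noteq> 0" using p(3) by (intro of_nat_nonzero) auto
    moreover have "\<theta> i \<noteq> 0" using 1[OF ij(1)] p(3) by (auto simp: power_0_left split: if_splits)
    ultimately show False by simp
  qed
qed

lemma prod_linear_eqI:
  fixes q :: "'b::idom poly"
  assumes A: "finite A" and q: "degree q = card A" "lead_coeff q = 1" and inj: "inj_on x A"
    and roots: "\<And>i. i \<in> A \<Longrightarrow> poly q (x i) = 0"
  shows "(\<Prod>i\<in>A. [:- x i, 1:]) = q"
proof (rule ccontr)
  assume ne: "(\<Prod>i\<in>A. [:- x i, 1:]) \<noteq> q"
  define Q where "Q = (\<Prod>i\<in>A. [:- x i, 1:])"
  have Q: "degree Q = card A" "lead_coeff Q = 1"
    unfolding Q_def by (simp add: degree_prod_linear, subst lead_coeff_prod, simp)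
  have nz: "Q - q \<noteq> 0" using ne by (simp add: Q_def)
  have "card A = card (x ` A)" using inj by (simp add: card_image)
  also have "\<dots> \<le> card {z. poly (Q - q) z = 0}"
  proof (rule card_mono)
    show "finite {z. poly (Q - q) z = 0}" using nz by (rule poly_roots_finite)
    show "x ` A \<subseteq> {z. poly (Q - q) z = 0}"
      using A roots by (auto simp: Q_def poly_prod intro!: prod_zero)
  qed
  also have "\<dots> \<le> degree (Q - q)" using nz by (rule card_poly_roots_bound)
  finally have le: "card A \<le> degree (Q - q)" .
  have "degree (Q - q) \<le> card A" using Q q by (intro degree_diff_le) auto
  with le have "degree (Q - q) = card A" by simp
  moreover have "coeff (Q - q) (card A) = 0" using Q q by simp
  ultimately have "lead_coeff (Q - q) = 0" by simp
  then show False using nz by (simp only: leading_coeff_0_iff)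
qed

text \<open>A polynomial q of positive degree would take the value -1, since q + 1 has a
  root.\<close>

lemma poly_eq_0_of_alg_closed:
  fixes q :: "'a::alg_closed_field poly"
  assumes "\<And>z. poly q z = 0"
  shows "q = 0"
proof (cases "degree q = 0")
  case True
  then obtain c where "q = [:c:]" by (rule degree_eq_zeroE)
  then show ?thesis using assms[of 0] by simp
next
  case False
  then have "degree (q + 1) > 0" by (subst degree_add_eq_left) auto
  then obtain z where "poly (q + 1) z = 0" using alg_closed_imp_poly_has_root by blast
  then show ?thesis using assms[of z] by simp
qed

lemma degree_trinomial:
  assumes "2 \<le> n"
  shows "degree (monom 1 n + [:b, a :: 'b::comm_ring_1:]) = n"
  using assms by (subst degree_add_eq_left) (auto simp: degree_monom_eq intro: le_less_trans[OF degree_pCons_le])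

text \<open>Provides the fibre of the curve over each parameter value: the roots in any order are
  coordinates of a point with a = t, b = -1.\<close>

lemma trinomial_splits:
  fixes t :: "'a::alg_closed_field"
  assumes n: "2 \<le> n"
  shows "\<exists>y. (\<Prod>i\<in>{1..n}. [:- y i, 1:]) = monom 1 n + [:-1, t:]"
proof -
  let ?q = "monom 1 n + [:-1, t:]"
  have deg: "degree ?q = n" by (rule degree_trinomial[OF n])
  have lead: "lead_coeff ?q = 1" unfolding deg using n by (auto simp: coeff_pCons split: nat.splits)
  have "?q \<noteq> 0" using deg n by force
  then obtain A where A: "size A = n" "?q = (\<Prod>z\<in>#A. [:-z, 1:])"
    using alg_closed_imp_factorization[of ?q] deg lead by auto
  obtain zs where zs: "mset zs = A" using ex_mset by blast
  then have len: "length zs = n" using A(1) by auto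
  have "?q = prod_list (map (\<lambda>z. [:-z, 1:]) zs)"
    unfolding A(2) zs[symmetric] by (simp add: prod_mset_prod_list flip: mset_map)
  also have "\<dots> = (\<Prod>i\<in>{0..<n}. [:- (zs ! i), 1:])"
    unfolding prod.list_conv_set_nth by (simp add: len)
  also have "\<dots> = (\<Prod>i\<in>{1..n}. [:- (zs ! (i - 1)), 1:])"
    by (rule prod.reindex_bij_witness[of _ "\<lambda>i. i - 1" Suc]) auto
  finally show ?thesis by (intro exI[of _ "\<lambda>i. zs ! (i - 1)"], rule sym)
qed

lemma (in prime_char) power_sum_step:
  assumes Q: "(\<Prod>i\<in>{1..p - 1}. [:- x i, 1:]) = monom 1 (p - 1) + [:-1, t :: 'b:]"
  shows "(\<Sum>i\<in>{1..p - 1}. x i ^ (k + (p - 1)))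
    = (\<Sum>i\<in>{1..p - 1}. x i ^ k) - t * (\<Sum>i\<in>{1..p - 1}. x i ^ Suc k)"
proof -
  have "x i ^ (k + (p - 1)) = x i ^ k - t * x i ^ Suc k" if "i \<in> {1..p - 1}" for i
  proof -
    have "x i ^ (p - 1) + t * x i = 1" using trinomial_root[OF Q that] by simp
    then have "x i ^ (p - 1) = 1 - t * x i" by (simp add: eq_diff_eq)
    then show ?thesis by (simp only: power_add) (simp add: algebra_simps)
  qed
  then have "(\<Sum>i\<in>{1..p - 1}. x i ^ (k + (p - 1))) = (\<Sum>i\<in>{1..p - 1}. x i ^ k - t * x i ^ Suc k)"
    by (rule sum.cong[OF refl])
  then show ?thesis by (simp only: sum_subtractf sum_distrib_left)
qed

section \<open>The branch through a normalized rational point\<close>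

locale curve_point =
  fixes p :: nat and \<theta> :: "nat \<Rightarrow> 'a::alg_closed_field"
  assumes prime: "prime p" and CHAR: "CHAR('a) = p" and p7: "7 \<le> p"
    and theta_power: "\<And>i. i \<in> {1..p - 1} \<Longrightarrow> \<theta> i ^ (p - 1) = 1"
    and theta_inj: "inj_on \<theta> {1..p - 1}"
begin

sublocale K: prime_char p "TYPE('a)"
  by unfold_locales (fact prime CHAR p7)+

sublocale F: prime_char p "TYPE('a fps)"
  by unfold_locales (simp_all add: prime CHAR p7)

definition local_branch :: "nat \<Rightarrow> 'a fps" where
  "local_branch i = branch p (\<theta> i)"

lemma local_branch_nth_0 [simp]: "local_branch i $ 0 = \<theta> i"
  by (simp add: local_branch_def)

lemma theta_nonzero: "i \<in> {1..p - 1} \<Longrightarrow> \<theta> i \<noteq> 0"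
  using theta_power[of i] p7 by (auto simp: power_0_left split: if_splits)

text \<open>Over the power series ring the branches are p - 1 roots of the monic trinomial, distinct
  because their constant terms are; in a domain this forces the factorization.\<close>

lemma local_branch_trinomial: "(\<Prod>i\<in>{1..p - 1}. [:- local_branch i, 1:]) = monom 1 (p - 1) + [:-1, fps_X:]"
proof (rule prod_linear_eqI)
  have deg: "degree (monom 1 (p - 1) + [:-1, fps_X :: 'a fps:]) = p - 1"
    using p7 by (intro degree_trinomial) auto
  then show "degree (monom 1 (p - 1) + [:-1, fps_X :: 'a fps:]) = card {1..p - 1}" by simp
  show "lead_coeff (monom 1 (p - 1) + [:-1, fps_X :: 'a fps:]) = 1"
    unfolding deg using p7 by (auto simp: coeff_pCons split: nat.splits)
  show "inj_on local_branch {1..p - 1}"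
    using theta_inj by (metis local_branch_nth_0 inj_on_def)
  fix i assume i: "i \<in> {1..p - 1}"
  have e: "Suc (p - 1) = p" using p7 by simp
  have "\<theta> i ^ p = \<theta> i" using power_Suc[of "\<theta> i" "p - 1"] unfolding e theta_power[OF i] by simp
  then have "local_branch i = local_branch i ^ p + fps_X * local_branch i ^ 2" unfolding local_branch_def by (rule branch_eq[OF prime CHAR])
  then have "local_branch i * 1 = local_branch i * (local_branch i ^ (p - 1) + fps_X * local_branch i)"
    using power_Suc[of "local_branch i" "p - 1"] unfolding e by (simp add: power2_eq_square algebra_simps)
  moreover have "local_branch i \<noteq> 0" using theta_nonzero[OF i] local_branch_nth_0[of i] by (metis fps_zero_nth)
  ultimately have "1 = local_branch i ^ (p - 1) + fps_X * local_branch i" by (metis mult_left_cancel)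
  then show "poly (monom 1 (p - 1) + [:-1, fps_X:]) (local_branch i) = 0"
    by (simp add: poly_monom mult.commute add_diff_eq)
qed simp

lemma theta_trinomial: "(\<Prod>i\<in>{1..p - 1}. [:- \<theta> i, 1:]) = monom 1 (p - 1) + [:-1, 0:]"
proof (rule prod_linear_eqI)
  have deg: "degree (monom 1 (p - 1) + [:-1, 0 :: 'a:]) = p - 1"
    using p7 by (intro degree_trinomial) auto
  then show "degree (monom 1 (p - 1) + [:-1, 0 :: 'a:]) = card {1..p - 1}" by simp
  show "lead_coeff (monom 1 (p - 1) + [:-1, 0 :: 'a:]) = 1"
    unfolding deg using p7 by (auto simp: coeff_pCons split: nat.splits)
qed (use theta_inj theta_power in \<open>auto simp: poly_monom\<close>)

text \<open>One polynomial serves every specialization t in the field and also the formal branch,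
  where t is \<open>fps_X\<close>. Hence an identity between power sums that holds for all t in the
  field holds along the branch.\<close>

lemma power_sum_polynomial:
  "\<exists>q. (\<forall>t y. (\<Prod>i\<in>{1..p - 1}. [:- y i, 1:]) = monom 1 (p - 1) + [:-1, t:] \<longrightarrow>
           (\<Sum>i\<in>{1..p - 1}. y i ^ k) = poly q t) \<and>
       (\<Sum>i\<in>{1..p - 1}. local_branch i ^ k) = fps_of_poly q"
proof (induction k rule: less_induct)
  case (less k)
  note One_nat_def [simp del]
  consider "k = 0" | "k \<in> {1..p - 3}" | "k = p - 2" | "p - 1 \<le> k" using p7 by force
  then show ?case
  proof cases
    case 1
    then show ?thesis using p7 by (intro exI[of _ "-1"]) (simp add: K.of_nat_p_minus F.of_nat_p_minus fps_of_poly_uminus)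
  next
    case 2
    show ?thesis by (intro exI[of _ 0] conjI allI impI, unfold poly_0 fps_of_poly_0)
      (erule K.power_sums_trinomial(1)[OF _ 2], rule F.power_sums_trinomial(1)[OF local_branch_trinomial 2])
  next
    case 3
    then show ?thesis
      using K.power_sums_trinomial(2) F.power_sums_trinomial(2)[OF local_branch_trinomial]
      by (intro exI[of _ "[:0, 2:]"])
        (auto simp: fps_of_poly_pCons numeral_fps_const mult.commute)
  next
    case 4
    then obtain l where l: "k = l + (p - 1)" by (metis le_add_diff_inverse2)
    have "l < k" "Suc l < k" using l p7 by auto
    from less.IH[OF this(1)] less.IH[OF this(2)] obtain q r where
      q: "\<And>t y. (\<Prod>i\<in>{1..p - 1}. [:- y i, 1:]) = monom 1 (p - 1) + [:-1, t:] \<Longrightarrow>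
           (\<Sum>i\<in>{1..p - 1}. y i ^ l) = poly q t" "(\<Sum>i\<in>{1..p - 1}. local_branch i ^ l) = fps_of_poly q"
      and r: "\<And>t y. (\<Prod>i\<in>{1..p - 1}. [:- y i, 1:]) = monom 1 (p - 1) + [:-1, t:] \<Longrightarrow>
           (\<Sum>i\<in>{1..p - 1}. y i ^ Suc l) = poly r t" "(\<Sum>i\<in>{1..p - 1}. local_branch i ^ Suc l) = fps_of_poly r"
      by blast
    show ?thesis unfolding l
    proof (intro exI[of _ "q - [:0, 1:] * r"] conjI allI impI)
      fix t :: 'a and y assume y: "(\<Prod>i\<in>{1..p - 1}. [:- y i, 1:]) = monom 1 (p - 1) + [:-1, t:]"
      show "(\<Sum>i\<in>{1..p - 1}. y i ^ (l + (p - 1))) = poly (q - [:0, 1:] * r) t"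
        unfolding K.power_sum_step[OF y] q(1)[OF y] r(1)[OF y] by simp
    next
      show "(\<Sum>i\<in>{1..p - 1}. local_branch i ^ (l + (p - 1))) = fps_of_poly (q - [:0, 1:] * r)"
        unfolding F.power_sum_step[OF local_branch_trinomial] q(2) r(2) fps_of_poly_diff fps_of_poly_mult
          fps_of_poly_fps_X ..
    qed
  qed
qed

end

section \<open>Evaluation of homogeneous polynomials\<close>

definition monom_eval :: "(nat \<Rightarrow> 'b::comm_ring_1) \<Rightarrow> (nat \<Rightarrow>\<^sub>0 nat) \<Rightarrow> 'b" where
  "monom_eval x m = (\<Prod>i\<in>Poly_Mapping.keys m. x i ^ Poly_Mapping.lookup m i)"

definition monom_degree :: "(nat \<Rightarrow>\<^sub>0 nat) \<Rightarrow> nat" where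
  "monom_degree m = (\<Sum>i\<in>Poly_Mapping.keys m. Poly_Mapping.lookup m i)"

text \<open>The coefficient map allows the same substitution lemmas for points over the field and
  for points with power series coordinates.\<close>

definition mpoly_subst :: "('a \<Rightarrow> 'b::comm_ring_1) \<Rightarrow> (nat \<Rightarrow> 'b) \<Rightarrow> 'a::field mpoly \<Rightarrow> 'b" where
  "mpoly_subst \<kappa> x F =
     (\<Sum>m\<in>Poly_Mapping.keys F. \<kappa> (Poly_Mapping.lookup F m) * monom_eval x m)"

abbreviation mvar :: "nat \<Rightarrow> 'a::field mpoly" where
  "mvar i \<equiv> Poly_Mapping.single (Poly_Mapping.single i 1) 1"

abbreviation mconst :: "'a \<Rightarrow> 'a::field mpoly" where
  "mconst c \<equiv> Poly_Mapping.single 0 c"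

lemma mpoly_eval_eq_subst: "mpoly_eval x F = mpoly_subst (\<lambda>c. c) x F"
  by (simp add: mpoly_eval_def mpoly_subst_def monom_eval_def)

lemma monom_eval_superset:
  "finite S \<Longrightarrow> Poly_Mapping.keys m \<subseteq> S \<Longrightarrow> monom_eval x m = (\<Prod>i\<in>S. x i ^ Poly_Mapping.lookup m i)"
  unfolding monom_eval_def by (rule prod.mono_neutral_left) (auto simp: in_keys_iff)

lemma monom_degree_superset:
  "finite S \<Longrightarrow> Poly_Mapping.keys m \<subseteq> S \<Longrightarrow> monom_degree m = (\<Sum>i\<in>S. Poly_Mapping.lookup m i)"
  unfolding monom_degree_def by (rule sum.mono_neutral_left) (auto simp: in_keys_iff)

lemma monom_eval_add: "monom_eval x (m + m') = monom_eval x m * monom_eval x m'"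
proof -
  let ?S = "Poly_Mapping.keys m \<union> Poly_Mapping.keys m'"
  have "Poly_Mapping.keys (m + m') \<subseteq> ?S" by (rule Poly_Mapping.keys_add)
  then show ?thesis
    by (simp add: monom_eval_superset[of ?S] lookup_add power_add prod.distrib)
qed

lemma monom_degree_add: "monom_degree (m + m') = monom_degree m + monom_degree m'"
proof -
  let ?S = "Poly_Mapping.keys m \<union> Poly_Mapping.keys m'"
  have "Poly_Mapping.keys (m + m') \<subseteq> ?S" by (rule Poly_Mapping.keys_add)
  then show ?thesis
    by (simp add: monom_degree_superset[of ?S] lookup_add sum.distrib)
qed

lemma monom_eval_0 [simp]: "monom_eval x 0 = 1"
  by (simp add: monom_eval_def)

lemma monom_eval_single [simp]: "monom_eval x (Poly_Mapping.single i 1) = x i"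
  by (simp add: monom_eval_def)

lemma monom_degree_0 [simp]: "monom_degree 0 = 0"
  by (simp add: monom_degree_def)

lemma monom_degree_single [simp]: "monom_degree (Poly_Mapping.single i 1) = 1"
  by (simp add: monom_degree_def)

lemma monom_degree_eq_0_iff: "monom_degree m = 0 \<longleftrightarrow> m = 0"
  by (auto simp: monom_degree_def in_keys_iff intro: poly_mapping_eqI)

lemma monom_split:
  fixes m :: "nat \<Rightarrow>\<^sub>0 nat"
  assumes "i \<in> Poly_Mapping.keys m"
  shows "\<exists>m'. m = Poly_Mapping.single i 1 + m' \<and> Poly_Mapping.keys m' \<subseteq> Poly_Mapping.keys m"
proof (intro exI[of _ "m - Poly_Mapping.single i 1"] conjI)
  show "m = Poly_Mapping.single i 1 + (m - Poly_Mapping.single i 1)"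
    using assms by (intro poly_mapping_eqI) (auto simp: lookup_add lookup_minus lookup_single in_keys_iff when_def)
  show "Poly_Mapping.keys (m - Poly_Mapping.single i 1) \<subseteq> Poly_Mapping.keys m"
    by (auto simp: in_keys_iff lookup_minus)
qed

lemma mpoly_sum_monomials:
  "(F :: 'a::field mpoly) = (\<Sum>m\<in>Poly_Mapping.keys F. Poly_Mapping.single m (Poly_Mapping.lookup F m))"
  by (rule poly_mapping_eqI)
    (auto simp: lookup_sum lookup_single when_def in_keys_iff sum.delta' cong: if_cong)

locale mpoly_hom =
  fixes \<kappa> :: "'a::field \<Rightarrow> 'b::comm_ring_1"
  assumes \<kappa>_0: "\<kappa> 0 = 0" and \<kappa>_1: "\<kappa> 1 = 1"
    and \<kappa>_add: "\<And>a b. \<kappa> (a + b) = \<kappa> a + \<kappa> b"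
    and \<kappa>_mult: "\<And>a b. \<kappa> (a * b) = \<kappa> a * \<kappa> b"
begin

lemma subst_superset:
  "finite S \<Longrightarrow> Poly_Mapping.keys F \<subseteq> S \<Longrightarrow>
    mpoly_subst \<kappa> x F = (\<Sum>m\<in>S. \<kappa> (Poly_Mapping.lookup F m) * monom_eval x m)"
  unfolding mpoly_subst_def by (rule sum.mono_neutral_left) (auto simp: in_keys_iff \<kappa>_0)

lemma subst_0 [simp]: "mpoly_subst \<kappa> x 0 = 0"
  by (simp add: mpoly_subst_def)

lemma subst_single: "mpoly_subst \<kappa> x (Poly_Mapping.single m c) = \<kappa> c * monom_eval x m"
  by (subst subst_superset[of "{m}"]) auto

lemma subst_const [simp]: "mpoly_subst \<kappa> x (mconst c) = \<kappa> c"
  by (simp add: subst_single)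

lemma subst_1 [simp]: "mpoly_subst \<kappa> x 1 = 1"
  using subst_const[of x 1] by (simp add: \<kappa>_1)

lemma subst_var [simp]: "mpoly_subst \<kappa> x (mvar i) = x i"
  by (simp only: subst_single monom_eval_single \<kappa>_1 mult_1_left)

lemma subst_add [simp]: "mpoly_subst \<kappa> x (F + G) = mpoly_subst \<kappa> x F + mpoly_subst \<kappa> x G"
proof -
  let ?S = "Poly_Mapping.keys F \<union> Poly_Mapping.keys G"
  have "Poly_Mapping.keys (F + G) \<subseteq> ?S" by (rule Poly_Mapping.keys_add)
  then show ?thesis
    by (simp add: subst_superset[of ?S] lookup_add \<kappa>_add distrib_right sum.distrib)
qed

lemma subst_sum: "mpoly_subst \<kappa> x (sum f A) = (\<Sum>i\<in>A. mpoly_subst \<kappa> x (f i))"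
  by (induction A rule: infinite_finite_induct) simp_all

lemma subst_uminus [simp]: "mpoly_subst \<kappa> x (- F) = - mpoly_subst \<kappa> x F"
  using subst_add[of x F "- F"] by (simp add: eq_neg_iff_add_eq_0 add.commute)

lemma subst_diff [simp]: "mpoly_subst \<kappa> x (F - G) = mpoly_subst \<kappa> x F - mpoly_subst \<kappa> x G"
  using subst_add[of x F "- G"] by simp

lemma subst_mult [simp]: "mpoly_subst \<kappa> x (F * G) = mpoly_subst \<kappa> x F * mpoly_subst \<kappa> x G"
proof -
  let ?l = "Poly_Mapping.lookup" and ?K = "Poly_Mapping.keys"
  have "F * G = (\<Sum>m\<in>?K F. \<Sum>m'\<in>?K G. Poly_Mapping.single (m + m') (?l F m * ?l G m'))"
    by (subst mpoly_sum_monomials[of F], subst mpoly_sum_monomials[of G])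
      (simp add: sum_product mult_single)
  then have "mpoly_subst \<kappa> x (F * G)
      = (\<Sum>m\<in>?K F. \<Sum>m'\<in>?K G. (\<kappa> (?l F m) * monom_eval x m) * (\<kappa> (?l G m') * monom_eval x m'))"
    by (simp add: subst_sum subst_single \<kappa>_mult monom_eval_add mult_ac)
  then show ?thesis by (simp add: sum_product mpoly_subst_def)
qed

lemma subst_power [simp]: "mpoly_subst \<kappa> x (F ^ k) = mpoly_subst \<kappa> x F ^ k"
  by (induction k) simp_all

lemma subst_prod: "mpoly_subst \<kappa> x (prod f A) = (\<Prod>i\<in>A. mpoly_subst \<kappa> x (f i))"
  by (induction A rule: infinite_finite_induct) simp_all

end

interpretation eval: mpoly_hom "\<lambda>c. c :: 'a::field"
  rewrites "mpoly_subst (\<lambda>c. c) = mpoly_eval"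
  by unfold_locales (simp_all add: fun_eq_iff mpoly_eval_eq_subst)

interpretation eval_fps: mpoly_hom "fps_const :: 'a::field \<Rightarrow> 'a fps"
  by unfold_locales simp_all

lemma linear_form_eq: "linear_form n a = (\<Sum>i\<in>{1..n}. mconst (a i) * mvar i)"
  by (simp add: linear_form_def mult_single)

lemma homog_iff: "homog n d = {F \<in> mpolys n. \<forall>m\<in>Poly_Mapping.keys F. monom_degree m = d}"
  by (simp add: homog_def monom_degree_def)

lemma keys_multE:
  assumes "m \<in> Poly_Mapping.keys (F * G :: 'a::field mpoly)"
  obtains m1 m2 where "m = m1 + m2" "m1 \<in> Poly_Mapping.keys F" "m2 \<in> Poly_Mapping.keys G"
  using assms Poly_Mapping.keys_mult[of F G] by blast

lemma mpolys_0 [simp]: "0 \<in> mpolys n"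
  by (simp add: mpolys_def)

lemma mpolys_add [intro]: "F \<in> mpolys n \<Longrightarrow> G \<in> mpolys n \<Longrightarrow> F + G \<in> mpolys n"
  using Poly_Mapping.keys_add[of F G] unfolding mpolys_def by blast

lemma mpolys_uminus [intro]: "F \<in> mpolys n \<Longrightarrow> - F \<in> mpolys n"
  by (simp add: mpolys_def in_keys_iff)

lemma mpolys_diff [intro]: "F \<in> mpolys n \<Longrightarrow> G \<in> mpolys n \<Longrightarrow> F - G \<in> mpolys n"
  using mpolys_add[of F n "- G"] mpolys_uminus[of G n] by simp

lemma mpolys_mult [intro]: "F \<in> mpolys n \<Longrightarrow> G \<in> mpolys n \<Longrightarrow> F * G \<in> mpolys n"
proof -
  assume FG: "F \<in> mpolys n" "G \<in> mpolys n"
  have "Poly_Mapping.keys m \<subseteq> {1..n}" if m: "m \<in> Poly_Mapping.keys (F * G)" for m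
  proof -
    from m obtain m1 m2 where "m = m1 + m2" "m1 \<in> Poly_Mapping.keys F" "m2 \<in> Poly_Mapping.keys G"
      by (rule keys_multE)
    then show ?thesis using FG Poly_Mapping.keys_add[of m1 m2] unfolding mpolys_def by blast
  qed
  then show ?thesis by (simp add: mpolys_def)
qed

lemma mpolys_const [intro]: "mconst c \<in> mpolys n"
  by (simp add: mpolys_def)

lemma mpolys_1 [simp]: "1 \<in> mpolys n"
  by (simp add: mpolys_def)

lemma mpolys_var [intro]: "i \<in> {1..n} \<Longrightarrow> mvar i \<in> mpolys n"
  by (simp add: mpolys_def)

lemma mpolys_power [intro]: "F \<in> mpolys n \<Longrightarrow> F ^ k \<in> mpolys n"
  by (induction k) auto

lemma mpolys_prod: "(\<And>i. i \<in> A \<Longrightarrow> f i \<in> mpolys n) \<Longrightarrow> prod f A \<in> mpolys n"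
  by (induction A rule: infinite_finite_induct) auto

lemma homog_mpolys: "F \<in> homog n d \<Longrightarrow> F \<in> mpolys n"
  by (simp add: homog_def)

lemma homog_0 [simp]: "0 \<in> homog n d"
  by (simp add: homog_iff)

lemma homog_add [intro]: "F \<in> homog n d \<Longrightarrow> G \<in> homog n d \<Longrightarrow> F + G \<in> homog n d"
  using Poly_Mapping.keys_add[of F G] mpolys_add[of F n G] unfolding homog_iff by blast

lemma homog_uminus [intro]: "F \<in> homog n d \<Longrightarrow> - F \<in> homog n d"
  using mpolys_uminus[of F n] by (simp add: homog_iff in_keys_iff)

lemma homog_diff [intro]: "F \<in> homog n d \<Longrightarrow> G \<in> homog n d \<Longrightarrow> F - G \<in> homog n d"
  using homog_add[of F n d "- G"] homog_uminus[of G n d] by simp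

lemma homog_mult: "F \<in> homog n d \<Longrightarrow> G \<in> homog n e \<Longrightarrow> F * G \<in> homog n (d + e)"
  unfolding homog_iff by (auto elim!: keys_multE simp: monom_degree_add)

lemma homog_const: "mconst c \<in> homog n 0"
  using mpolys_const[of c n] by (auto simp: homog_iff)

lemma homog_const_mult: "F \<in> homog n d \<Longrightarrow> mconst c * F \<in> homog n d"
  using homog_mult[OF homog_const] by fastforce

lemma homog_var: "i \<in> {1..n} \<Longrightarrow> mvar i \<in> homog n 1"
  using mpolys_var[of i n] monom_degree_single[of i] unfolding homog_iff by auto

lemma homog_power: "F \<in> homog n d \<Longrightarrow> F ^ k \<in> homog n (k * d)"
proof (induction k)
  case 0
  then show ?case using homog_const[of 1 n] by simp
next
  case (Suc k)
  then show ?case using homog_mult[of F n d "F ^ k" "k * d"] by simp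
qed

lemma homog_sum: "(\<And>i. i \<in> A \<Longrightarrow> f i \<in> homog n d) \<Longrightarrow> sum f A \<in> homog n d"
  by (induction A rule: infinite_finite_induct) auto

lemma homog_linear_form: "linear_form n a \<in> homog n 1"
  unfolding linear_form_eq by (intro homog_sum homog_const_mult homog_var)

lemma mpoly_eval_homog_scale:
  assumes "F \<in> homog n d"
  shows "mpoly_eval (\<lambda>i. c * x i) F = c ^ d * mpoly_eval x F"
proof -
  have "monom_eval (\<lambda>i. c * x i) m = c ^ monom_degree m * monom_eval x m" for m
    by (simp add: monom_eval_def monom_degree_def power_mult_distrib prod.distrib power_sum)
  moreover have "monom_degree m = d" if "m \<in> Poly_Mapping.keys F" for m
    using assms that by (simp add: homog_iff)
  ultimately show ?thesis
    by (simp add: mpoly_eval_eq_subst mpoly_subst_def sum_distrib_left mult_ac)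
qed

section \<open>Polynomials vanishing on the curve\<close>

declare One_nat_def [simp del]

lemma mpoly_subst_cong:
  assumes "F \<in> mpolys n" "\<And>i. i \<in> {1..n} \<Longrightarrow> x i = y i"
  shows "mpoly_subst \<kappa> x F = mpoly_subst \<kappa> y F"
  unfolding mpoly_subst_def
proof (rule sum.cong)
  fix m assume "m \<in> Poly_Mapping.keys F"
  then have "Poly_Mapping.keys m \<subseteq> {1..n}" using assms(1) by (auto simp: mpolys_def)
  then have "monom_eval x m = monom_eval y m"
    unfolding monom_eval_def using assms(2) by (intro prod.cong) auto
  then show "\<kappa> (Poly_Mapping.lookup F m) * monom_eval x m = \<kappa> (Poly_Mapping.lookup F m) * monom_eval y m"
    by simp
qed simp

text \<open>Distributivity: a sum over all maps of a product is a product of sums, so each monomial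
  turns into a product of power sums.\<close>

lemma sum_maps_mpoly_subst:
  assumes "F \<in> mpolys n"
  shows "(\<Sum>g\<in>Pi\<^sub>E {1..n} (\<lambda>_. {1..n}). mpoly_subst \<kappa> (\<lambda>i. x (g i)) F)
    = (\<Sum>m\<in>Poly_Mapping.keys F. \<kappa> (Poly_Mapping.lookup F m) *
         (\<Prod>i\<in>{1..n}. \<Sum>j\<in>{1..n}. x j ^ Poly_Mapping.lookup m i))"
proof -
  have "(\<Sum>g\<in>Pi\<^sub>E {1..n} (\<lambda>_. {1..n}). mpoly_subst \<kappa> (\<lambda>i. x (g i)) F)
    = (\<Sum>m\<in>Poly_Mapping.keys F. \<Sum>g\<in>Pi\<^sub>E {1..n} (\<lambda>_. {1..n}).
         \<kappa> (Poly_Mapping.lookup F m) * monom_eval (\<lambda>i. x (g i)) m)"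
    unfolding mpoly_subst_def by (rule sum.swap)
  also have "\<dots> = (\<Sum>m\<in>Poly_Mapping.keys F. \<kappa> (Poly_Mapping.lookup F m) *
      (\<Sum>g\<in>Pi\<^sub>E {1..n} (\<lambda>_. {1..n}). \<Prod>i\<in>{1..n}. x (g i) ^ Poly_Mapping.lookup m i))"
  proof (rule sum.cong)
    fix m assume "m \<in> Poly_Mapping.keys F"
    then have "Poly_Mapping.keys m \<subseteq> {1..n}" using assms by (auto simp: mpolys_def)
    then have "monom_eval (\<lambda>i. x (g i)) m = (\<Prod>i\<in>{1..n}. x (g i) ^ Poly_Mapping.lookup m i)" for g
      by (intro monom_eval_superset) auto
    then show "(\<Sum>g\<in>Pi\<^sub>E {1..n} (\<lambda>_. {1..n}). \<kappa> (Poly_Mapping.lookup F m) * monom_eval (\<lambda>i. x (g i)) m)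
      = \<kappa> (Poly_Mapping.lookup F m) * (\<Sum>g\<in>Pi\<^sub>E {1..n} (\<lambda>_. {1..n}). \<Prod>i\<in>{1..n}. x (g i) ^ Poly_Mapping.lookup m i)"
      by (simp add: sum_distrib_left)
  qed simp
  finally show ?thesis by (subst prod_sum_PiE) simp_all
qed

lemma monom_eval_nth_0: "monom_eval x m $ 0 = monom_eval (\<lambda>i. x i $ 0) m"
proof -
  have "(\<Prod>i\<in>A. x i ^ e i) $ 0 = (\<Prod>i\<in>A. (x i $ 0) ^ e i)" for A :: "nat set" and e
    by (induction A rule: infinite_finite_induct) (simp_all add: fps_power_zeroth)
  then show ?thesis by (simp add: monom_eval_def)
qed

lemma mpoly_subst_nth_0: "mpoly_subst fps_const x F $ 0 = mpoly_eval (\<lambda>i. x i $ 0) F"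
  by (simp add: mpoly_eval_eq_subst mpoly_subst_def fps_sum_nth monom_eval_nth_0)

lemma fps_X_factor: "f $ 0 = 0 \<Longrightarrow> f = fps_X * fps_shift 1 (f :: 'a::comm_ring_1 fps)"
  by (rule fps_ext) (simp add: not_less)

lemma vanishing_ideal_0 [simp]: "0 \<in> vanishing_ideal n V"
  by (simp add: vanishing_ideal_def)

lemma vanishing_ideal_add:
  "F \<in> vanishing_ideal n V \<Longrightarrow> G \<in> vanishing_ideal n V \<Longrightarrow> F + G \<in> vanishing_ideal n V"
  by (auto simp: vanishing_ideal_def)

lemma vanishing_ideal_mult:
  "F \<in> mpolys n \<Longrightarrow> G \<in> vanishing_ideal n V \<Longrightarrow> F * G \<in> vanishing_ideal n V"
  by (auto simp: vanishing_ideal_def)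

context curve_point
begin

abbreviation V :: "(nat \<Rightarrow> 'a) set" where
  "V \<equiv> power_sum_curve p"

abbreviation branch_eval :: "'a mpoly \<Rightarrow> 'a fps" where
  "branch_eval \<equiv> mpoly_subst fps_const local_branch"

lemma branch_eval_nth_0 [simp]: "branch_eval F $ 0 = mpoly_eval \<theta> F"
  by (simp add: mpoly_subst_nth_0)

lemma in_curveI:
  assumes y: "(\<Prod>i\<in>{1..p - 1}. [:- y i, 1:]) = monom 1 (p - 1) + [:-1, t:]"
    and g: "bij_betw g {1..p - 1} {1..p - 1}"
  shows "(\<lambda>i. y (g i)) \<in> V"
proof -
  have "(\<Sum>i\<in>{1..p - 1}. y (g i) ^ k) = 0" if "k \<in> {1..p - 3}" for k
    using sum.reindex_bij_betw[OF g, of "\<lambda>i. y i ^ k"] K.power_sums_trinomial(1)[OF y that] by simp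
  moreover have "y (g 1) \<noteq> 0"
  proof -
    have "1 \<in> {1..p - 1}" using p7 by simp
    then have "g 1 \<in> {1..p - 1}" by (rule bij_betw_apply[OF g])
    from K.trinomial_root[OF y this] p7 show ?thesis by (auto simp: power_0_left)
  qed
  ultimately show ?thesis
    using p7 by (auto simp: power_sum_curve_def proj_points_def intro!: bexI[of _ 1])
qed

text \<open>Summing over all maps of the index set, rather than over permutations, makes the sum of the
  values of a polynomial a polynomial in the power sums; the factor \<open>D\<close> removes the maps that are
  not injective, and the power of \<open>H\<close> singles out the identity.\<close>

lemma branch_eval_vanishing:
  assumes A: "A \<in> vanishing_ideal (p - 1) V"
  shows "branch_eval A = 0"
proof (rule ccontr)
  assume nz: "branch_eval A \<noteq> 0"
  define n where "n = p - 1"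
  define M where "M = subdegree (branch_eval A)"
  define D :: "'a mpoly" where "D = (\<Prod>i\<in>{1..n}. \<Prod>j\<in>{1..n} - {i}. mvar i - mvar j)"
  define H :: "'a mpoly" where "H = (\<Prod>i\<in>{1..n}. \<Prod>j\<in>{1..n} - {i}. mvar i - mconst (\<theta> j))"
  \<comment> \<open>For a map g other than the identity, \<open>H\<close> at the branches permuted
    or repeated by g has constant term zero, so its power is divisible by t^(M+1). Coefficient
    \<open>M\<close>, the leading one of \<open>branch_eval A\<close>, thus sees the identity
    alone.\<close>
  define B where "B = A * (D * H ^ Suc M)"
  define maps where "maps = Pi\<^sub>E {1..n} (\<lambda>_. {1..n})"
  have fin: "finite maps" unfolding maps_def by (intro finite_PiE) auto
  have AI: "A \<in> mpolys n" "\<And>x. x \<in> V \<Longrightarrow> mpoly_eval x A = 0"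
    using A by (auto simp: vanishing_ideal_def n_def)
  have DH: "D \<in> mpolys n" "H \<in> mpolys n"
    unfolding D_def H_def by (intro mpolys_prod mpolys_diff mpolys_var mpolys_const; simp)+
  then have B: "B \<in> mpolys n" unfolding B_def using AI by (intro mpolys_mult mpolys_power)
  have \<theta>_ne: "\<theta> i \<noteq> \<theta> j" if "i \<in> {1..n}" "j \<in> {1..n}" "i \<noteq> j" for i j
    using theta_inj that unfolding n_def inj_on_def by blast
  have D\<theta>: "mpoly_eval \<theta> D \<noteq> 0" "mpoly_eval \<theta> H \<noteq> 0"
    unfolding D_def H_def eval.subst_prod using \<theta>_ne by (auto simp: prod_zero_iff)
  obtain q where q: "\<And>k t y. (\<Prod>i\<in>{1..n}. [:- y i, 1:]) = monom 1 n + [:-1, t:] \<Longrightarrow>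
           (\<Sum>i\<in>{1..n}. y i ^ k) = poly (q k) t" "\<And>k. (\<Sum>i\<in>{1..n}. local_branch i ^ k) = fps_of_poly (q k)"
    using power_sum_polynomial unfolding n_def by metis
  define N where "N = (\<Sum>m\<in>Poly_Mapping.keys B. smult (Poly_Mapping.lookup B m)
      (\<Prod>i\<in>{1..n}. q (Poly_Mapping.lookup m i)))"
  have "poly N t = 0" for t
  proof -
    have "2 \<le> n" using p7 by (simp add: n_def)
    from trinomial_splits[OF this, of t] obtain y where
      y: "(\<Prod>i\<in>{1..n}. [:- y i, 1:]) = monom 1 n + [:-1, t:]" by blast
    have "poly N t = (\<Sum>g\<in>maps. mpoly_eval (\<lambda>i. y (g i)) B)"
      unfolding mpoly_eval_eq_subst maps_def sum_maps_mpoly_subst[OF B]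
      by (simp add: N_def poly_sum poly_prod q(1)[OF y])
    also have "\<dots> = 0"
    proof (rule sum.neutral, rule ballI)
      fix g assume g: "g \<in> maps"
      then have img: "g ` {1..n} \<subseteq> {1..n}" by (auto simp: maps_def)
      show "mpoly_eval (\<lambda>i. y (g i)) B = 0"
      proof (cases "inj_on g {1..n}")
        case True
        then have "bij_betw g {1..n} {1..n}"
          using img by (simp add: bij_betw_def endo_inj_surj)
        then have "(\<lambda>i. y (g i)) \<in> V" using in_curveI[of y t g] y unfolding n_def by blast
        then show ?thesis by (simp add: B_def AI(2))
      next
        case False
        then obtain i j where ij: "i \<in> {1..n}" "j \<in> {1..n}" "i \<noteq> j" "g i = g j"
          by (auto simp: inj_on_def)
        then have "mpoly_eval (\<lambda>i. y (g i)) D = 0"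
          unfolding D_def eval.subst_prod
          by (intro prod_zero bexI[of _ i] bexI[of _ j]) auto
        then show ?thesis by (simp add: B_def)
      qed
    qed
    finally show ?thesis .
  qed
  then have N0: "N = 0" by (rule poly_eq_0_of_alg_closed)
  have "(\<Sum>g\<in>maps. mpoly_subst fps_const (\<lambda>i. local_branch (g i)) B) = fps_of_poly N"
    unfolding maps_def sum_maps_mpoly_subst[OF B] N_def
    by (simp add: fps_of_poly_sum fps_of_poly_smult fps_of_poly_prod q(2))
  then have "(\<Sum>g\<in>maps. mpoly_subst fps_const (\<lambda>i. local_branch (g i)) B) = 0"
    by (simp only: N0 fps_of_poly_0)
  then have "0 = (\<Sum>g\<in>maps. mpoly_subst fps_const (\<lambda>i. local_branch (g i)) B $ M)"
    by (metis fps_sum_nth fps_zero_nth)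
  also have "\<dots> = (\<Sum>g\<in>maps. if g = restrict id {1..n} then branch_eval B $ M else 0)"
  proof (rule sum.cong[OF refl])
    fix g assume g: "g \<in> maps"
    show "mpoly_subst fps_const (\<lambda>i. local_branch (g i)) B $ M = (if g = restrict id {1..n} then branch_eval B $ M else 0)"
    proof (cases "g = restrict id {1..n}")
      case True
      then have "mpoly_subst fps_const (\<lambda>i. local_branch (g i)) B = branch_eval B"
        by (intro mpoly_subst_cong[OF B]) simp
      then show ?thesis using True by simp
    next
      case False
      have "\<exists>i\<in>{1..n}. g i \<noteq> i"
      proof (rule ccontr)
        assume *: "\<not> (\<exists>i\<in>{1..n}. g i \<noteq> i)"
        have "g = restrict id {1..n}"
        proof (rule PiE_ext[of _ "{1..n}" "\<lambda>_. {1..n}"])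
          show "g \<in> Pi\<^sub>E {1..n} (\<lambda>_. {1..n})" using g by (simp only: maps_def)
          show "restrict id {1..n} \<in> Pi\<^sub>E {1..n} (\<lambda>_. {1..n})" by simp
          fix k assume "k \<in> {1..n}"
          then show "g k = restrict id {1..n} k" using * by (simp only: restrict_apply' id_apply) blast
        qed
        then show False using False by contradiction
      qed
      then obtain i where i: "i \<in> {1..n}" "g i \<noteq> i" by blast
      have gi: "g i \<in> {1..n} - {i}" using g i unfolding maps_def by (blast dest: PiE_mem)
      have "mpoly_eval (\<lambda>i. \<theta> (g i)) H = 0"
        unfolding H_def eval.subst_prod
        using i gi by (intro prod_zero bexI[of _ i] bexI[of _ "g i"]) auto
      then have "mpoly_subst fps_const (\<lambda>i. local_branch (g i)) H $ 0 = 0"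
        by (simp add: mpoly_subst_nth_0)
      define h where "h = fps_shift 1 (mpoly_subst fps_const (\<lambda>i. local_branch (g i)) H)"
      have h: "mpoly_subst fps_const (\<lambda>i. local_branch (g i)) H = fps_X * h"
        unfolding h_def by (rule fps_X_factor) fact
      have "mpoly_subst fps_const (\<lambda>i. local_branch (g i)) B
          = mpoly_subst fps_const (\<lambda>i. local_branch (g i)) (A * D) * (fps_X * h) ^ Suc M"
        by (simp only: B_def eval_fps.subst_mult eval_fps.subst_power h mult.assoc)
      also have "\<dots> = fps_X ^ Suc M * (mpoly_subst fps_const (\<lambda>i. local_branch (g i)) (A * D) * h ^ Suc M)"
        unfolding power_mult_distrib by (rule mult.left_commute)
      finally have "mpoly_subst fps_const (\<lambda>i. local_branch (g i)) B
          = fps_X ^ Suc M * (mpoly_subst fps_const (\<lambda>i. local_branch (g i)) (A * D) * h ^ Suc M)" .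
      then have "mpoly_subst fps_const (\<lambda>i. local_branch (g i)) B $ M = 0"
        by (simp only: fps_X_power_mult_nth) simp
      then show ?thesis using False by simp
    qed
  qed
  also have "\<dots> = branch_eval B $ M"
  proof -
    have "restrict id {1..n} \<in> maps" by (simp add: maps_def)
    then show ?thesis using fin by (simp only: sum.delta if_True)
  qed
  also have "\<dots> = branch_eval A $ M * (mpoly_eval \<theta> D * mpoly_eval \<theta> H ^ Suc M)"
  proof -
    have "branch_eval B = branch_eval A * branch_eval (D * H ^ Suc M)"
      by (simp only: B_def eval_fps.subst_mult)
    then have "branch_eval B $ M = branch_eval A $ M * branch_eval (D * H ^ Suc M) $ 0"
      unfolding M_def by (simp only: nth_subdegree_mult_left)
    then show ?thesis by (simp add: fps_power_zeroth)
  qed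
  finally have "branch_eval A $ M = 0" using D\<theta> by simp
  then show False using nz unfolding M_def by (metis nth_subdegree_nonzero)
qed

end

section \<open>The local ring of the curve\<close>

context curve_point
begin

lemma one_in: "1 \<in> {1..p - 1}"
  using p7 by simp

lemma theta_1_nonzero: "\<theta> 1 \<noteq> 0"
  using theta_nonzero[OF one_in] .

definition param :: "'a mpoly" where
  "param = mconst (1 / 2) * (\<Sum>i\<in>{1..p - 1}. mvar i ^ (p - 2))"

lemma two_nonzero: "(2 :: 'a) \<noteq> 0"
  using K.of_nat_nonzero[of 2] p7 by simp

lemma homog_param: "param \<in> homog (p - 1) (p - 2)"
  unfolding param_def
  by (intro homog_const_mult homog_sum) (use homog_power[OF homog_var, of _ "p - 1" "p - 2"] in simp)

lemma branch_eval_param: "branch_eval param = fps_X"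
proof -
  have "branch_eval param = fps_const (1 / 2) * (2 * fps_X)"
    using F.power_sums_trinomial(2)[OF local_branch_trinomial]
    by (simp only: param_def eval_fps.subst_mult eval_fps.subst_const eval_fps.subst_sum
        eval_fps.subst_power eval_fps.subst_var)
  also have "\<dots> = fps_X" using two_nonzero
    by (rule_tac fps_ext) (simp add: numeral_fps_const)
  finally show ?thesis .
qed

text \<open>Subtracting the trinomial equations of X_j and X_1 eliminates b; a itself is the form
  \<open>param\<close>, half the power sum of exponent p - 2.\<close>

lemma param_relation:
  assumes j: "j \<in> {1..p - 1}"
  shows "mvar j ^ (p - 1) - mvar 1 ^ (p - 1) + param * (mvar j - mvar 1) \<in> vanishing_ideal (p - 1) V"
proof -
  have "mpoly_eval x (mvar j ^ (p - 1) - mvar 1 ^ (p - 1) + param * (mvar j - mvar 1)) = 0"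
    if x: "x \<in> V" for x
  proof -
    obtain a b where Q: "(\<Prod>i\<in>{1..p - 1}. [:- x i, 1:]) = monom 1 (p - 1) + [:b, a:]"
      using K.trinomial_of_power_sums[of x] x by (auto simp: power_sum_curve_def)
    have "mpoly_eval x param = a"
      using K.power_sums_trinomial(2)[OF Q] two_nonzero
      by (simp only: param_def eval.subst_mult eval.subst_const eval.subst_sum
          eval.subst_power eval.subst_var) simp
    moreover have "x j ^ (p - 1) - x 1 ^ (p - 1) + a * (x j - x 1)
        = (x j ^ (p - 1) + a * x j + b) - (x 1 ^ (p - 1) + a * x 1 + b)"
      by (simp add: algebra_simps)
    ultimately show ?thesis
      using K.trinomial_root[OF Q j] K.trinomial_root[OF Q one_in]
      by (simp only: eval.subst_add eval.subst_diff eval.subst_mult eval.subst_power eval.subst_var) simp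
  qed
  moreover have "mvar j ^ (p - 1) - mvar 1 ^ (p - 1) + param * (mvar j - mvar 1) \<in> mpolys (p - 1)"
    using j one_in homog_mpolys[OF homog_param]
    by (intro mpolys_add mpolys_diff mpolys_mult mpolys_power mpolys_var)
  ultimately show ?thesis by (simp add: vanishing_ideal_def)
qed

text \<open>Membership of the class of \<open>F\<close> in the ideal generated by the uniformizer \<open>param\<close>, in the
  homogeneous local ring of the curve.\<close>

definition param_multiple :: "nat \<Rightarrow> nat \<Rightarrow> 'a mpoly \<Rightarrow> bool" where
  "param_multiple m d F \<longleftrightarrow> (\<exists>e G k F'. G \<in> homog (p - 1) e \<and> mpoly_eval \<theta> G \<noteq> 0 \<and>
     F' \<in> homog (p - 1) k \<and> k + m * (p - 2) = d + e \<and>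
     G * F - param ^ m * F' \<in> vanishing_ideal (p - 1) V)"

lemma param_multiple_0: "param_multiple 1 d 0"
  unfolding param_multiple_def
proof (intro exI conjI)
  \<comment> \<open>The cofactor 1 would fail for small \<open>d\<close>: the degree of
    \<open>F'\<close> is d + e - (p - 2), so e must supply p - 2.\<close>
  show "mvar 1 ^ (p - 2) \<in> homog (p - 1) ((p - 2) * 1)" by (intro homog_power homog_var one_in)
  show "mpoly_eval \<theta> (mvar 1 ^ (p - 2)) \<noteq> 0" using theta_1_nonzero by simp
  show "0 \<in> homog (p - 1) d" by simp
  show "d + 1 * (p - 2) = d + (p - 2) * 1" by simp
  show "mvar 1 ^ (p - 2) * 0 - param ^ 1 * 0 \<in> vanishing_ideal (p - 1) V" by simp
qed

lemma param_multiple_add: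
  assumes "param_multiple m d F1" "param_multiple m d F2"
  shows "param_multiple m d (F1 + F2)"
proof -
  obtain e1 G1 k1 H1 where 1: "G1 \<in> homog (p - 1) e1" "mpoly_eval \<theta> G1 \<noteq> 0"
     "H1 \<in> homog (p - 1) k1" "k1 + m * (p - 2) = d + e1"
     "G1 * F1 - param ^ m * H1 \<in> vanishing_ideal (p - 1) V"
    using assms(1) unfolding param_multiple_def by blast
  obtain e2 G2 k2 H2 where 2: "G2 \<in> homog (p - 1) e2" "mpoly_eval \<theta> G2 \<noteq> 0"
     "H2 \<in> homog (p - 1) k2" "k2 + m * (p - 2) = d + e2"
     "G2 * F2 - param ^ m * H2 \<in> vanishing_ideal (p - 1) V"
    using assms(2) unfolding param_multiple_def by blast
  have k: "e1 + k2 = e2 + k1" using 1(4) 2(4) by linarith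
  show ?thesis unfolding param_multiple_def
  proof (intro exI conjI)
    show "G1 * G2 \<in> homog (p - 1) (e1 + e2)" by (intro homog_mult 1 2)
    show "mpoly_eval \<theta> (G1 * G2) \<noteq> 0" using 1 2 by simp
    have "G1 * H2 \<in> homog (p - 1) (e2 + k1)" using homog_mult[OF 1(1) 2(3)] k by simp
    then show "G2 * H1 + G1 * H2 \<in> homog (p - 1) (e2 + k1)"
      by (rule homog_add[OF homog_mult[OF 2(1) 1(3)]])
    show "e2 + k1 + m * (p - 2) = d + (e1 + e2)" using 1(4) by linarith
    have "G2 * (G1 * F1 - param ^ m * H1) + G1 * (G2 * F2 - param ^ m * H2) \<in> vanishing_ideal (p - 1) V"
      by (intro vanishing_ideal_add vanishing_ideal_mult homog_mpolys[OF 1(1)] homog_mpolys[OF 2(1)] 1(5) 2(5))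
    moreover have "G2 * (G1 * F1 - param ^ m * H1) + G1 * (G2 * F2 - param ^ m * H2)
        = G1 * G2 * (F1 + F2) - param ^ m * (G2 * H1 + G1 * H2)"
      by (simp add: algebra_simps)
    ultimately show "G1 * G2 * (F1 + F2) - param ^ m * (G2 * H1 + G1 * H2) \<in> vanishing_ideal (p - 1) V"
      by simp
  qed
qed

lemma param_multiple_mult:
  assumes "param_multiple m d F" "H \<in> homog (p - 1) h"
  shows "param_multiple m (h + d) (H * F)"
proof -
  obtain e G k F' where 1: "G \<in> homog (p - 1) e" "mpoly_eval \<theta> G \<noteq> 0"
     "F' \<in> homog (p - 1) k" "k + m * (p - 2) = d + e"
     "G * F - param ^ m * F' \<in> vanishing_ideal (p - 1) V"
    using assms(1) unfolding param_multiple_def by blast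
  show ?thesis unfolding param_multiple_def
  proof (intro exI conjI)
    show "G \<in> homog (p - 1) e" "mpoly_eval \<theta> G \<noteq> 0" by fact+
    show "H * F' \<in> homog (p - 1) (h + k)" by (intro homog_mult 1 assms)
    show "h + k + m * (p - 2) = h + d + e" using 1(4) by linarith
    have "H * (G * F - param ^ m * F') \<in> vanishing_ideal (p - 1) V"
      by (intro vanishing_ideal_mult homog_mpolys[OF assms(2)] 1(5))
    moreover have "H * (G * F - param ^ m * F') = G * (H * F) - param ^ m * (H * F')"
      by (simp add: algebra_simps)
    ultimately show "G * (H * F) - param ^ m * (H * F') \<in> vanishing_ideal (p - 1) V" by simp
  qed
qed

lemma param_multiple_sum:
  "(\<And>i. i \<in> A \<Longrightarrow> param_multiple 1 d (f i)) \<Longrightarrow> param_multiple 1 d (sum f A)"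
  by (induction A rule: infinite_finite_induct) (simp_all add: param_multiple_0 param_multiple_add)

lemma mconst_power: "mconst c ^ k = mconst (c ^ k)"
  by (induction k) (simp_all add: mult_single)

text \<open>The coordinate vector of the same point with first entry 1, in the form that
  \<open>mpoly_eval_homog_scale\<close> produces.\<close>

definition ratio :: "nat \<Rightarrow> 'a" where
  "ratio i = 1 / \<theta> 1 * \<theta> i"

text \<open>As \<open>ratio i\<close> is a root of unity, \<open>mvar i - ratio i * mvar 1\<close> divides
  \<open>mvar i ^ (p - 1) - mvar 1 ^ (p - 1)\<close>, and the cofactor does not vanish at the point.\<close>

lemma param_multiple_linear:
  assumes j: "j \<in> {1..p - 1}"
  shows "param_multiple 1 1 (mvar j - mconst (ratio j) * mvar 1)"
proof -
  let ?x = "mvar j :: 'a mpoly" and ?y = "mconst (ratio j) * mvar 1 :: 'a mpoly"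
  have r: "ratio j ^ (p - 1) = 1" and r1: "ratio j * \<theta> 1 = \<theta> j"
    using theta_power[OF j] theta_power[OF one_in] theta_1_nonzero
    by (simp_all add: ratio_def power_divide)
  define G where "G = (\<Sum>i<p - 1. ?y ^ (p - 1 - Suc i) * ?x ^ i)"
  have hx: "?x \<in> homog (p - 1) 1" and hy: "?y \<in> homog (p - 1) 1"
    using j one_in by (intro homog_const_mult homog_var; simp)+
  have "?x ^ (p - 1) - ?y ^ (p - 1) = (?x - ?y) * G"
    unfolding G_def by (rule power_diff_sumr2)
  moreover have "?y ^ (p - 1) = mvar 1 ^ (p - 1)"
    by (simp add: power_mult_distrib mconst_power r)
  ultimately have G: "G * (?x - ?y) = ?x ^ (p - 1) - mvar 1 ^ (p - 1)" by (simp add: mult.commute)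
  show ?thesis unfolding param_multiple_def
  proof (intro exI conjI)
    show "G \<in> homog (p - 1) (p - 2)" unfolding G_def
    proof (rule homog_sum)
      fix i assume "i \<in> {..<p - 1}"
      then have "(p - 1 - Suc i) * 1 + i * 1 = p - 2" by auto
      then show "?y ^ (p - 1 - Suc i) * ?x ^ i \<in> homog (p - 1) (p - 2)"
        using homog_mult[OF homog_power[OF hy] homog_power[OF hx]] by metis
    qed
    have "mpoly_eval \<theta> G = (\<Sum>i<p - 1. \<theta> j ^ (p - 1 - Suc i) * \<theta> j ^ i)"
      by (simp only: G_def eval.subst_sum eval.subst_mult eval.subst_power eval.subst_var eval.subst_const r1)
    also have "\<dots> = (\<Sum>i<p - 1. \<theta> j ^ (p - 2))"
    proof (rule sum.cong)
      fix i assume "i \<in> {..<p - 1}"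
      then have "p - 1 - Suc i + i = p - 2" by auto
      then show "\<theta> j ^ (p - 1 - Suc i) * \<theta> j ^ i = \<theta> j ^ (p - 2)" by (metis power_add)
    qed simp
    also have "\<dots> = of_nat (p - 1) * \<theta> j ^ (p - 2)" by simp
    finally show "mpoly_eval \<theta> G \<noteq> 0"
      using K.of_nat_nonzero[of "p - 1"] theta_nonzero[OF j] p7 by simp
    show "mvar 1 - ?x \<in> homog (p - 1) 1" by (intro homog_diff homog_var one_in hx)
    show "1 + 1 * (p - 2) = 1 + (p - 2)" by simp
    have "G * (?x - ?y) - param ^ 1 * (mvar 1 - ?x) = ?x ^ (p - 1) - mvar 1 ^ (p - 1) + param * (?x - mvar 1)"
      unfolding G by (simp add: algebra_simps)
    then show "G * (?x - ?y) - param ^ 1 * (mvar 1 - ?x) \<in> vanishing_ideal (p - 1) V"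
      using param_relation[OF j] by simp
  qed
qed

text \<open>Telescoping: replace the variables one at a time by multiples of \<open>mvar 1\<close>,
  each replacement costing a multiple of a linear form covered by
  \<open>param_multiple_linear\<close>.\<close>

lemma param_multiple_monomial:
  assumes "Poly_Mapping.keys m \<subseteq> {1..p - 1}" "monom_degree m = d"
  shows "param_multiple 1 d (Poly_Mapping.single m 1 - mconst (monom_eval ratio m) * mvar 1 ^ d)"
  using assms
proof (induction d arbitrary: m)
  case 0
  then have "m = 0" by (simp add: monom_degree_eq_0_iff)
  then show ?case by (simp add: param_multiple_0)
next
  case (Suc d)
  then have "m \<noteq> 0" by auto
  then obtain i where i: "i \<in> Poly_Mapping.keys m" by (metis all_not_in_conv keys_eq_empty)
  from monom_split[OF i] obtain m' where
    m': "m = Poly_Mapping.single i 1 + m'" "Poly_Mapping.keys m' \<subseteq> Poly_Mapping.keys m" by blast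
  have "monom_degree m' = d"
    using Suc.prems(2) unfolding m'(1) monom_degree_add monom_degree_single by simp
  with Suc m'(2) have IH: "param_multiple 1 d (Poly_Mapping.single m' 1 - mconst (monom_eval ratio m') * mvar 1 ^ d)"
    by blast
  have ip: "i \<in> {1..p - 1}" using i Suc.prems(1) by blast
  let ?M = "Poly_Mapping.single m' 1 :: 'a mpoly" and ?c = "monom_eval ratio m'"
  have "param_multiple 1 (1 + d) (mvar i * (?M - mconst ?c * mvar 1 ^ d))"
    by (intro param_multiple_mult IH homog_var ip)
  moreover have "param_multiple 1 (d + 1) ((mconst ?c * mvar 1 ^ d) * (mvar i - mconst (ratio i) * mvar 1))"
    using homog_power[OF homog_var[OF one_in], of d]
    by (intro param_multiple_mult param_multiple_linear ip homog_const_mult) simp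
  ultimately have "param_multiple 1 (Suc d) (mvar i * (?M - mconst ?c * mvar 1 ^ d)
      + (mconst ?c * mvar 1 ^ d) * (mvar i - mconst (ratio i) * mvar 1))"
    by (simp only: plus_1_eq_Suc add.commute[of d 1] param_multiple_add)
  moreover have "mvar i * (?M - mconst ?c * mvar 1 ^ d)
      + (mconst ?c * mvar 1 ^ d) * (mvar i - mconst (ratio i) * mvar 1)
    = mvar i * ?M - (mconst (ratio i) * mconst ?c) * mvar 1 ^ Suc d"
    unfolding power_Suc by (simp only: right_diff_distrib mult_ac) simp
  moreover have "mvar i * ?M = Poly_Mapping.single m 1"
    by (simp only: m'(1) mult_single mult_1_left)
  moreover have "mconst (ratio i) * mconst ?c = mconst (monom_eval ratio m)"
    by (simp only: m'(1) mult_single monom_eval_add monom_eval_single add_0_left)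
  ultimately show ?case by simp
qed

text \<open>Since F vanishes at \<open>ratio\<close>, it equals the combination of the differences
  x^m - ratio^m X_1^d with its own coefficients. Thus \<open>param\<close> generates the maximal
  ideal at the point.\<close>

lemma param_multiple_of_zero:
  assumes F: "F \<in> homog (p - 1) d" and z: "mpoly_eval \<theta> F = 0"
  shows "param_multiple 1 d F"
proof -
  let ?l = "Poly_Mapping.lookup F"
  have "mpoly_eval ratio F = 0"
    using mpoly_eval_homog_scale[OF F, of "1 / \<theta> 1" \<theta>] z by (simp add: ratio_def[abs_def])
  then have z': "(\<Sum>m\<in>Poly_Mapping.keys F. ?l m * monom_eval ratio m) = 0"
    by (simp add: mpoly_eval_eq_subst mpoly_subst_def)
  have "param_multiple 1 d (\<Sum>m\<in>Poly_Mapping.keys F. mconst (?l m) *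
      (Poly_Mapping.single m 1 - mconst (monom_eval ratio m) * mvar 1 ^ d))"
  proof (rule param_multiple_sum)
    fix m assume "m \<in> Poly_Mapping.keys F"
    then have "Poly_Mapping.keys m \<subseteq> {1..p - 1}" "monom_degree m = d"
      using F by (auto simp: homog_iff mpolys_def)
    from param_multiple_mult[OF param_multiple_monomial[OF this] homog_const]
    show "param_multiple 1 d (mconst (?l m) *
      (Poly_Mapping.single m 1 - mconst (monom_eval ratio m) * mvar 1 ^ d))"
      by (simp only: add_0_left)
  qed
  also have "(\<Sum>m\<in>Poly_Mapping.keys F. mconst (?l m) *
      (Poly_Mapping.single m 1 - mconst (monom_eval ratio m) * mvar 1 ^ d))
    = (\<Sum>m\<in>Poly_Mapping.keys F. Poly_Mapping.single m (?l m))
      - (\<Sum>m\<in>Poly_Mapping.keys F. mconst (?l m * monom_eval ratio m)) * mvar 1 ^ d"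
    by (simp add: right_diff_distrib sum_subtractf sum_distrib_right mult_single mult.assoc[symmetric])
  also have "(\<Sum>m\<in>Poly_Mapping.keys F. mconst (?l m * monom_eval ratio m)) = mconst 0"
    by (rule poly_mapping_eqI) (simp add: lookup_sum lookup_single when_def z' flip: z')
  finally show ?thesis by (simp flip: mpoly_sum_monomials)
qed

lemma param_multiple_relation:
  assumes "G * F - param ^ m * F' \<in> vanishing_ideal (p - 1) V"
  shows "branch_eval G * branch_eval F = fps_X ^ m * branch_eval F'"
  using branch_eval_vanishing[OF assms] by (simp add: branch_eval_param)

text \<open>One factor \<open>param\<close> is split off at a time: while the order exceeds m, the
  cofactor \<open>F'\<close> vanishes at the point and is itself a multiple.\<close>

lemma param_multiple_of_order:
  assumes F: "F \<in> homog (p - 1) d" and ord: "\<And>i. i < m \<Longrightarrow> branch_eval F $ i = 0"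
  shows "param_multiple m d F"
  using ord
proof (induction m)
  case 0
  show ?case unfolding param_multiple_def
  proof (intro exI conjI)
    show "1 \<in> homog (p - 1) 0" using homog_const[of 1] by simp
    show "F \<in> homog (p - 1) d" by fact
  qed simp_all
next
  case (Suc m)
  then have "param_multiple m d F" by simp
  then obtain e G k F' where 1: "G \<in> homog (p - 1) e" "mpoly_eval \<theta> G \<noteq> 0"
     "F' \<in> homog (p - 1) k" "k + m * (p - 2) = d + e"
     "G * F - param ^ m * F' \<in> vanishing_ideal (p - 1) V"
    unfolding param_multiple_def by blast
  have "(branch_eval G * branch_eval F) $ m = 0"
    using Suc.prems by (simp add: fps_mult_nth)
  then have "mpoly_eval \<theta> F' = 0"
    unfolding param_multiple_relation[OF 1(5)] fps_X_power_mult_nth by simp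
  from param_multiple_of_zero[OF 1(3) this] obtain e' G' k' F'' where 2:
     "G' \<in> homog (p - 1) e'" "mpoly_eval \<theta> G' \<noteq> 0"
     "F'' \<in> homog (p - 1) k'" "k' + (p - 2) = k + e'"
     "G' * F' - param * F'' \<in> vanishing_ideal (p - 1) V"
    unfolding param_multiple_def by (auto simp only: power_one_right mult_1_left)
  show ?case unfolding param_multiple_def
  proof (intro exI conjI)
    show "G' * G \<in> homog (p - 1) (e' + e)" by (intro homog_mult 1 2)
    show "mpoly_eval \<theta> (G' * G) \<noteq> 0" using 1 2 by simp
    show "F'' \<in> homog (p - 1) k'" by fact
    show "k' + Suc m * (p - 2) = d + (e' + e)" using 1(4) 2(4) by simp
    have "G' * (G * F - param ^ m * F') + param ^ m * (G' * F' - param * F'') \<in> vanishing_ideal (p - 1) V"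
      using homog_mpolys[OF 2(1)] homog_mpolys[OF homog_param]
      by (intro vanishing_ideal_add vanishing_ideal_mult mpolys_power 1(5) 2(5))
    moreover have "G' * (G * F - param ^ m * F') + param ^ m * (G' * F' - param * F'')
        = G' * G * F - param ^ Suc m * F''"
      by (simp add: algebra_simps)
    ultimately show "G' * G * F - param ^ Suc m * F'' \<in> vanishing_ideal (p - 1) V" by simp
  qed
qed

text \<open>With m the order of L, both F and L are a^m times a cofactor up to units, and the
  cofactor \<open>H2\<close> of L does not vanish at the point. Cross-multiplying cancels a^m and
  exhibits F as a local multiple of L.\<close>

lemma linear_form_multiple:
  assumes F: "F \<in> homog (p - 1) d"
    and l: "branch_eval (linear_form (p - 1) a) \<noteq> 0"
    and ord: "\<And>i. i < subdegree (branch_eval (linear_form (p - 1) a)) \<Longrightarrow> branch_eval F $ i = 0"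
  shows "\<exists>e G A B. G \<in> homog (p - 1) e \<and> mpoly_eval \<theta> G \<noteq> 0 \<and> A \<in> vanishing_ideal (p - 1) V \<and>
    B \<in> mpolys (p - 1) \<and> G * F = A + linear_form (p - 1) a * B"
proof -
  define L where "L = linear_form (p - 1) a"
  define m where "m = subdegree (branch_eval L)"
  obtain e1 G1 k1 H1 where 1: "G1 \<in> homog (p - 1) e1" "mpoly_eval \<theta> G1 \<noteq> 0"
     "H1 \<in> homog (p - 1) k1" "G1 * F - param ^ m * H1 \<in> vanishing_ideal (p - 1) V"
    using param_multiple_of_order[OF F, of m] ord unfolding param_multiple_def m_def L_def by blast
  have hL: "L \<in> homog (p - 1) 1" unfolding L_def by (rule homog_linear_form)
  obtain e2 G2 k2 H2 where 2: "G2 \<in> homog (p - 1) e2" "mpoly_eval \<theta> G2 \<noteq> 0"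
     "H2 \<in> homog (p - 1) k2" "G2 * L - param ^ m * H2 \<in> vanishing_ideal (p - 1) V"
    using param_multiple_of_order[OF hL, of m] nth_less_subdegree_zero
    unfolding param_multiple_def m_def by blast
  have "(branch_eval G2 * branch_eval L) $ m \<noteq> 0"
    using 2(2) l unfolding m_def L_def nth_subdegree_mult_right by simp
  then have H2: "mpoly_eval \<theta> H2 \<noteq> 0"
    unfolding param_multiple_relation[OF 2(4)] fps_X_power_mult_nth by simp
  show ?thesis
  proof (intro exI conjI)
    show "H2 * G1 \<in> homog (p - 1) (k2 + e1)" by (intro homog_mult 1 2)
    show "mpoly_eval \<theta> (H2 * G1) \<noteq> 0" using 1 H2 by simp
    show "H2 * (G1 * F - param ^ m * H1) + (- H1) * (G2 * L - param ^ m * H2) \<in> vanishing_ideal (p - 1) V"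
      using homog_mpolys[OF 2(3)] homog_mpolys[OF 1(3)]
      by (intro vanishing_ideal_add vanishing_ideal_mult mpolys_uminus 1(4) 2(4))
    show "H1 * G2 \<in> mpolys (p - 1)"
      by (intro mpolys_mult homog_mpolys[OF 1(3)] homog_mpolys[OF 2(1)])
    show "H2 * G1 * F = H2 * (G1 * F - param ^ m * H1) + (- H1) * (G2 * L - param ^ m * H2)
        + linear_form (p - 1) a * (H1 * G2)"
      unfolding L_def by (simp add: algebra_simps)
  qed
qed

end

section \<open>Intersection multiplicities\<close>

interpretation fps_vs: vector_space "\<lambda>(c :: 'a::field) f. fps_const c * f"
proof
  fix a b :: 'a and x y :: "'a fps"
  show "fps_const a * (x + y) = fps_const a * x + fps_const a * y" by (rule distrib_left)
  show "fps_const (a + b) * x = fps_const a * x + fps_const b * x"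
    by (simp only: fps_const_add[symmetric] distrib_right)
  show "fps_const a * (fps_const b * x) = fps_const (a * b) * x"
    by (simp only: fps_const_mult[symmetric] mult.assoc)
  show "fps_const 1 * x = x" by simp
qed

text \<open>In a linear relation the term of least order has nothing to cancel its leading
  coefficient.\<close>

lemma independent_of_subdegree:
  fixes S :: "'a::field fps set"
  assumes nz: "0 \<notin> S" and inj: "inj_on subdegree S"
  shows "fps_vs.independent S"
proof
  assume "fps_vs.dependent S"
  then obtain t u where t: "finite t" "t \<subseteq> S" "(\<Sum>v\<in>t. fps_const (u v) * v) = 0" "\<exists>v\<in>t. u v \<noteq> 0"
    unfolding fps_vs.dependent_explicit by blast
  define t' where "t' = {v \<in> t. u v \<noteq> 0}"
  have t': "finite t'" "t' \<noteq> {}" "t' \<subseteq> S" using t by (auto simp: t'_def)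
  define w where "w = arg_min_on subdegree t'"
  have w: "w \<in> t'" "\<And>v. v \<in> t' \<Longrightarrow> subdegree w \<le> subdegree v"
    unfolding w_def using arg_min_if_finite(1)[OF t'(1,2)] arg_min_least[OF t'(1,2)] by blast+
  have "(\<Sum>v\<in>t. fps_const (u v) * v) $ subdegree w = (\<Sum>v\<in>t. if v = w then u w * w $ subdegree w else 0)"
    unfolding fps_sum_nth
  proof (rule sum.cong)
    fix v assume v: "v \<in> t"
    show "(fps_const (u v) * v) $ subdegree w = (if v = w then u w * w $ subdegree w else 0)"
    proof (cases "v = w \<or> u v = 0")
      case True
      then show ?thesis by (cases "v = w") simp_all
    next
      case False
      then have vt: "v \<in> t'" using v by (simp add: t'_def)
      then have "subdegree v \<noteq> subdegree w"
        using False inj_onD[OF inj, of v w] w(1) t'(3) by blast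
      then have "subdegree w < subdegree v" using w(2)[OF vt] by simp
      then have "v $ subdegree w = 0" by (rule nth_less_subdegree_zero)
      then show ?thesis using False by simp
    qed
  qed simp
  also have "\<dots> = u w * w $ subdegree w"
  proof -
    have "w \<in> t" using w(1) by (simp add: t'_def)
    then show ?thesis using t(1) by (simp only: sum.delta if_True)
  qed
  finally have "u w * w $ subdegree w = 0" unfolding t(3) fps_zero_nth ..
  moreover have "w \<noteq> 0" "u w \<noteq> 0" using w(1) t'(3) nz by (auto simp: t'_def)
  ultimately show False by simp
qed

lemma finite_subdegrees_span:
  fixes T :: "'a::field fps set"
  assumes "finite T"
  shows "finite (subdegree ` (fps_vs.span T - {0}))"
proof (rule ccontr)
  let ?U = "fps_vs.span T - {0}"
  assume "infinite (subdegree ` ?U)"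
  then obtain D where D: "finite D" "card D = Suc (card T)" "D \<subseteq> subdegree ` ?U"
    using infinite_arbitrarily_large by metis
  define S where "S = inv_into ?U subdegree ` D"
  have sub: "subdegree (inv_into ?U subdegree d) = d" if "d \<in> D" for d
    using that D(3) by (intro f_inv_into_f) blast
  have S: "S \<subseteq> ?U" unfolding S_def
  proof (rule image_subsetI)
    fix d assume "d \<in> D"
    then show "inv_into ?U subdegree d \<in> ?U" using D(3) by (intro inv_into_into) blast
  qed
  have inj: "inj_on (inv_into ?U subdegree) D" by (rule inj_on_inverseI[where g = subdegree], rule sub)
  have "inj_on subdegree S"
    unfolding S_def by (rule inj_on_inverseI[where g = "inv_into ?U subdegree"]) (auto simp only: sub)
  then have "fps_vs.independent S" using S by (intro independent_of_subdegree) auto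
  then have "card S \<le> card T" using fps_vs.independent_span_bound[OF assms] S by blast
  then show False using D(2) inj by (simp add: S_def card_image)
qed

context curve_point
begin

lemma mpoly_nonzero: "mpoly_eval \<theta> G \<noteq> 0 \<Longrightarrow> G \<noteq> 0"
  by auto

lemma branch_eval_inverse: "mpoly_eval \<theta> G \<noteq> 0 \<Longrightarrow> branch_eval G * inverse (branch_eval G) = 1"
  by (rule inverse_mult_eq_1') simp

text \<open>Extends \<open>branch_eval\<close> to fractions regular at the point; the choice of
  representative is harmless because numerators and denominators cross-multiply.\<close>

definition fract_eval :: "'a mpoly fract \<Rightarrow> 'a fps" where
  "fract_eval \<phi> = (SOME y. \<exists>F G. \<phi> = Fract F G \<and> mpoly_eval \<theta> G \<noteq> 0 \<and>
     y = branch_eval F * inverse (branch_eval G))"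

lemma fract_eval_Fract:
  assumes G: "mpoly_eval \<theta> G \<noteq> 0"
  shows "fract_eval (Fract F G) = branch_eval F * inverse (branch_eval G)"
  unfolding fract_eval_def
proof (rule some_equality)
  show "\<exists>F' G'. Fract F G = Fract F' G' \<and> mpoly_eval \<theta> G' \<noteq> 0 \<and>
      branch_eval F * inverse (branch_eval G) = branch_eval F' * inverse (branch_eval G')"
    using G by blast
  fix y assume "\<exists>F' G'. Fract F G = Fract F' G' \<and> mpoly_eval \<theta> G' \<noteq> 0 \<and>
      y = branch_eval F' * inverse (branch_eval G')"
  then obtain F' G' where y: "Fract F G = Fract F' G'" "mpoly_eval \<theta> G' \<noteq> 0"
      "y = branch_eval F' * inverse (branch_eval G')" by blast
  have "F * G' = F' * G" using y(1) G y(2) by (simp add: eq_fract mpoly_nonzero)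
  then have e: "branch_eval F * branch_eval G' = branch_eval F' * branch_eval G"
    by (metis eval_fps.subst_mult)
  have "y = branch_eval F' * inverse (branch_eval G') * (branch_eval G * inverse (branch_eval G))"
    by (simp only: y(3) branch_eval_inverse[OF G] mult_1_right)
  also have "\<dots> = (branch_eval F' * branch_eval G) * inverse (branch_eval G') * inverse (branch_eval G)"
    by (simp only: mult_ac)
  also have "\<dots> = branch_eval F * inverse (branch_eval G) * (branch_eval G' * inverse (branch_eval G'))"
    unfolding e[symmetric] by (simp only: mult_ac)
  finally show "y = branch_eval F * inverse (branch_eval G)"
    by (simp only: branch_eval_inverse[OF y(2)] mult_1_right)
qed

abbreviation local_ring :: "'a mpoly fract set" where
  "local_ring \<equiv> localize (p - 1) (mpolys (p - 1)) \<theta>"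

lemma local_ringI:
  "F \<in> homog (p - 1) d \<Longrightarrow> G \<in> homog (p - 1) d \<Longrightarrow> mpoly_eval \<theta> G \<noteq> 0 \<Longrightarrow> Fract F G \<in> local_ring"
  unfolding localize_def using homog_mpolys by blast

lemma local_ringE:
  assumes "\<phi> \<in> local_ring"
  obtains F G d where "\<phi> = Fract F G" "F \<in> homog (p - 1) d" "G \<in> homog (p - 1) d" "mpoly_eval \<theta> G \<noteq> 0"
  using assms unfolding localize_def by blast

lemma local_ring_add:
  assumes "\<phi> \<in> local_ring" "\<psi> \<in> local_ring"
  shows "\<phi> + \<psi> \<in> local_ring" "fract_eval (\<phi> + \<psi>) = fract_eval \<phi> + fract_eval \<psi>"
proof -
  obtain F G d where 1: "\<phi> = Fract F G" "F \<in> homog (p - 1) d" "G \<in> homog (p - 1) d" "mpoly_eval \<theta> G \<noteq> 0"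
    using assms(1) by (rule local_ringE)
  obtain F' G' d' where 2: "\<psi> = Fract F' G'" "F' \<in> homog (p - 1) d'" "G' \<in> homog (p - 1) d'" "mpoly_eval \<theta> G' \<noteq> 0"
    using assms(2) by (rule local_ringE)
  have e: "\<phi> + \<psi> = Fract (F * G' + F' * G) (G * G')"
    using 1 2 by (simp add: add_fract mpoly_nonzero)
  have nz: "mpoly_eval \<theta> (G * G') \<noteq> 0" using 1 2 by simp
  have "F' * G \<in> homog (p - 1) (d + d')" using homog_mult[OF 2(2) 1(3)] by (simp add: add.commute)
  then show "\<phi> + \<psi> \<in> local_ring"
    unfolding e
    using local_ringI[OF homog_add[OF homog_mult[OF 1(2) 2(3)]] homog_mult[OF 1(3) 2(3)] nz] by blast
  have inv: "inverse (branch_eval G * branch_eval G') = inverse (branch_eval G) * inverse (branch_eval G')"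
    by (rule fps_inverse_mult)
  have rearrange: "(a * b' + a' * b) * (i * i') = (a * i) * (b' * i') + (a' * i') * (b * i)"
    for a b a' b' i i' :: "'a fps" by (simp add: algebra_simps)
  have "fract_eval (\<phi> + \<psi>) = (branch_eval F * inverse (branch_eval G)) * (branch_eval G' * inverse (branch_eval G'))
     + (branch_eval F' * inverse (branch_eval G')) * (branch_eval G * inverse (branch_eval G))"
    unfolding e fract_eval_Fract[OF nz] eval_fps.subst_add eval_fps.subst_mult inv
    by (rule rearrange)
  then show "fract_eval (\<phi> + \<psi>) = fract_eval \<phi> + fract_eval \<psi>"
    by (simp only: branch_eval_inverse[OF 1(4)] branch_eval_inverse[OF 2(4)] mult_1_right
        1(1) 2(1) fract_eval_Fract[OF 1(4)] fract_eval_Fract[OF 2(4)])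
qed

lemma local_ring_mult:
  assumes "\<phi> \<in> local_ring" "\<psi> \<in> local_ring"
  shows "\<phi> * \<psi> \<in> local_ring" "fract_eval (\<phi> * \<psi>) = fract_eval \<phi> * fract_eval \<psi>"
proof -
  obtain F G d where 1: "\<phi> = Fract F G" "F \<in> homog (p - 1) d" "G \<in> homog (p - 1) d" "mpoly_eval \<theta> G \<noteq> 0"
    using assms(1) by (rule local_ringE)
  obtain F' G' d' where 2: "\<psi> = Fract F' G'" "F' \<in> homog (p - 1) d'" "G' \<in> homog (p - 1) d'" "mpoly_eval \<theta> G' \<noteq> 0"
    using assms(2) by (rule local_ringE)
  have e: "\<phi> * \<psi> = Fract (F * F') (G * G')" using 1 2 by simp
  have nz: "mpoly_eval \<theta> (G * G') \<noteq> 0" using 1 2 by simp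
  show "\<phi> * \<psi> \<in> local_ring"
    unfolding e by (rule local_ringI[OF homog_mult[OF 1(2) 2(2)] homog_mult[OF 1(3) 2(3)] nz])
  show "fract_eval (\<phi> * \<psi>) = fract_eval \<phi> * fract_eval \<psi>"
    unfolding e fract_eval_Fract[OF nz] unfolding 1(1) 2(1) fract_eval_Fract[OF 1(4)] fract_eval_Fract[OF 2(4)]
    by (simp add: fps_inverse_mult mult_ac)
qed

lemma local_ring_const: "const_fract c \<in> local_ring" "fract_eval (const_fract c) = fps_const c"
proof -
  have one: "(1 :: 'a mpoly) \<in> homog (p - 1) 0" using homog_const[of 1] by simp
  show "const_fract c \<in> local_ring"
    unfolding const_fract_def by (rule local_ringI[OF homog_const one]) simp
  show "fract_eval (const_fract c) = fps_const c"
    unfolding const_fract_def by (subst fract_eval_Fract) simp_all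
qed

lemma const_fract_minus_1: "const_fract (- 1) = (- 1 :: 'a mpoly fract)"
  by (simp add: const_fract_def single_uminus One_fract_def)

lemma local_ring_diff:
  assumes "\<phi> \<in> local_ring" "\<psi> \<in> local_ring"
  shows "\<phi> - \<psi> \<in> local_ring" "fract_eval (\<phi> - \<psi>) = fract_eval \<phi> - fract_eval \<psi>"
proof -
  have e: "\<phi> - \<psi> = \<phi> + const_fract (- 1) * \<psi>" by (simp add: const_fract_minus_1)
  have m: "const_fract (- 1) * \<psi> \<in> local_ring" by (intro local_ring_mult local_ring_const assms)
  show "\<phi> - \<psi> \<in> local_ring" unfolding e by (intro local_ring_add assms m)
  have "fract_eval (\<phi> - \<psi>) = fract_eval \<phi> + fps_const (- 1) * fract_eval \<psi>"
    unfolding e local_ring_add(2)[OF assms(1) m] local_ring_mult(2)[OF local_ring_const(1) assms(2)]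
      local_ring_const(2) ..
  then show "fract_eval (\<phi> - \<psi>) = fract_eval \<phi> - fract_eval \<psi>" by (simp flip: fps_const_neg)
qed

lemma local_ring_sum:
  assumes "\<And>i. i \<in> I \<Longrightarrow> f i \<in> local_ring"
  shows "sum f I \<in> local_ring \<and> fract_eval (sum f I) = (\<Sum>i\<in>I. fract_eval (f i))"
proof -
  have z: "0 \<in> local_ring" "fract_eval 0 = 0"
    using local_ring_const[of 0] by (simp_all add: const_fract_def Zero_fract_def)
  show ?thesis using assms
    by (induction I rule: infinite_finite_induct) (simp_all add: z local_ring_add)
qed

lemma local_ring_power:
  assumes "\<phi> \<in> local_ring"
  shows "\<phi> ^ k \<in> local_ring \<and> fract_eval (\<phi> ^ k) = fract_eval \<phi> ^ k"
proof -
  have o: "1 \<in> local_ring" "fract_eval 1 = 1"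
    using local_ring_const[of 1] by (simp_all add: const_fract_def One_fract_def)
  show ?thesis by (induction k) (simp_all add: o local_ring_mult assms)
qed

abbreviation hyperplane_ideal :: "(nat \<Rightarrow> 'a) \<Rightarrow> 'a mpoly fract set" where
  "hyperplane_ideal a \<equiv> localize (p - 1) {A + linear_form (p - 1) a * B | A B.
     A \<in> vanishing_ideal (p - 1) V \<and> B \<in> mpolys (p - 1)} \<theta>"

lemma fract_eval_hyperplane_ideal:
  assumes "\<phi> \<in> hyperplane_ideal a"
  shows "\<exists>y. fract_eval \<phi> = branch_eval (linear_form (p - 1) a) * y"
proof -
  obtain A B G where *: "\<phi> = Fract (A + linear_form (p - 1) a * B) G" "mpoly_eval \<theta> G \<noteq> 0"
    "A \<in> vanishing_ideal (p - 1) V"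
    using assms unfolding localize_def by blast
  show ?thesis unfolding *(1) fract_eval_Fract[OF *(2)]
    by (simp add: branch_eval_vanishing[OF *(3)] mult.assoc)
qed

text \<open>Together with \<open>fract_eval_hyperplane_ideal\<close> this identifies the ideal with
  the local functions whose order is at least that of the linear form.\<close>

lemma hyperplane_idealI:
  assumes \<phi>: "\<phi> \<in> local_ring" and l: "branch_eval (linear_form (p - 1) a) \<noteq> 0"
    and ord: "\<And>i. i < subdegree (branch_eval (linear_form (p - 1) a)) \<Longrightarrow> fract_eval \<phi> $ i = 0"
  shows "\<phi> \<in> hyperplane_ideal a"
proof -
  obtain F H d where 1: "\<phi> = Fract F H" "F \<in> homog (p - 1) d" "H \<in> homog (p - 1) d" "mpoly_eval \<theta> H \<noteq> 0"
    using \<phi> by (rule local_ringE)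
  have "branch_eval F = fract_eval \<phi> * branch_eval H"
    unfolding 1(1) fract_eval_Fract[OF 1(4)] using branch_eval_inverse[OF 1(4)]
    by (simp only: mult.assoc mult.commute[of "inverse _"] mult_1_right)
  then have "branch_eval F $ i = 0" if "i < subdegree (branch_eval (linear_form (p - 1) a))" for i
    using that ord by (simp add: fps_mult_nth)
  from linear_form_multiple[OF 1(2) l this] obtain e G A B where 2: "G \<in> homog (p - 1) e"
    "mpoly_eval \<theta> G \<noteq> 0" "A \<in> vanishing_ideal (p - 1) V" "B \<in> mpolys (p - 1)"
    "G * F = A + linear_form (p - 1) a * B" by blast
  have "\<phi> = Fract (G * F) (G * H)" using 1(1,4) 2(2) by (simp add: mult_fract_cancel mpoly_nonzero)
  moreover have "G * F \<in> homog (p - 1) (e + d)" "G * H \<in> homog (p - 1) (e + d)"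
    by (intro homog_mult 1 2)+
  moreover have "mpoly_eval \<theta> (G * H) \<noteq> 0" using 1(4) 2(2) by simp
  moreover have "G * F \<in> {A + linear_form (p - 1) a * B | A B.
     A \<in> vanishing_ideal (p - 1) V \<and> B \<in> mpolys (p - 1)}" using 2(3-5) by blast
  ultimately show ?thesis unfolding localize_def by blast
qed

definition uniformizer :: "'a mpoly fract" where
  "uniformizer = Fract param (mvar 1 ^ (p - 2))"

lemma uniformizer_power:
  "uniformizer ^ k \<in> local_ring" "fract_eval (uniformizer ^ k) \<noteq> 0"
  "subdegree (fract_eval (uniformizer ^ k)) = k"
proof -
  have nz: "mpoly_eval \<theta> (mvar 1 ^ (p - 2)) \<noteq> 0"
    using theta_1_nonzero by (simp only: eval.subst_power eval.subst_var) simp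
  have "mvar 1 ^ (p - 2) \<in> homog (p - 1) (p - 2)"
    using homog_power[OF homog_var[OF one_in], of "p - 2"] by simp
  then have u: "uniformizer \<in> local_ring"
    unfolding uniformizer_def using homog_param nz by (intro local_ringI)
  have e: "fract_eval uniformizer = fps_X * inverse (branch_eval (mvar 1 ^ (p - 2)))"
    unfolding uniformizer_def fract_eval_Fract[OF nz] branch_eval_param ..
  have "inverse (branch_eval (mvar 1 ^ (p - 2))) $ 0 \<noteq> 0" using theta_1_nonzero by simp
  then have c: "fract_eval uniformizer $ 1 \<noteq> 0" "fract_eval uniformizer $ 0 = 0"
    unfolding e by simp_all
  then have s: "fract_eval uniformizer \<noteq> 0" by force
  have s': "subdegree (fract_eval uniformizer) = 1"
    using c by (intro subdegreeI) simp_all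
  show "uniformizer ^ k \<in> local_ring" "fract_eval (uniformizer ^ k) \<noteq> 0"
    "subdegree (fract_eval (uniformizer ^ k)) = k"
    using local_ring_power[OF u, of k] s s' by simp_all
qed

lemma uniformizer_sum: "(\<Sum>k<m. const_fract (c k) * uniformizer ^ k) \<in> local_ring"
proof -
  have "const_fract (c k) * uniformizer ^ k \<in> local_ring" for k
    by (intro local_ring_mult local_ring_const uniformizer_power)
  then show ?thesis using local_ring_sum[of "{..<m}" "\<lambda>k. const_fract (c k) * uniformizer ^ k"] by blast
qed

lemma uniformizer_expansion:
  assumes "\<phi> \<in> local_ring"
  shows "\<exists>c. \<forall>i<m. fract_eval (\<phi> - (\<Sum>k<m. const_fract (c k) * uniformizer ^ k)) $ i = 0"
proof (induction m)
  case 0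
  show ?case by simp
next
  case (Suc m)
  then obtain c where c: "\<forall>i<m. fract_eval (\<phi> - (\<Sum>k<m. const_fract (c k) * uniformizer ^ k)) $ i = 0"
    by blast
  define \<psi> where "\<psi> = \<phi> - (\<Sum>k<m. const_fract (c k) * uniformizer ^ k)"
  define t where "t = fract_eval (uniformizer ^ m)"
  define b where "b = fract_eval \<psi> $ m / t $ m"
  have \<psi>: "\<psi> \<in> local_ring" unfolding \<psi>_def by (intro local_ring_diff assms uniformizer_sum)
  have t: "t $ m \<noteq> 0" "\<And>i. i < m \<Longrightarrow> t $ i = 0"
    using nth_subdegree_nonzero[OF uniformizer_power(2)[of m]] nth_less_subdegree_zero[of _ t]
    unfolding t_def uniformizer_power(3) by blast+
  have "fract_eval (\<psi> - const_fract b * uniformizer ^ m) = fract_eval \<psi> - fps_const b * t"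
    unfolding t_def local_ring_diff(2)[OF \<psi> local_ring_mult(1)[OF local_ring_const(1) uniformizer_power(1)]]
      local_ring_mult(2)[OF local_ring_const(1) uniformizer_power(1)] local_ring_const(2) ..
  moreover have "(fract_eval \<psi> - fps_const b * t) $ i = 0" if "i < Suc m" for i
  proof (cases "i = m")
    case True
    then show ?thesis using t(1) by (simp add: b_def)
  next
    case False
    then have "i < m" using that by simp
    then have "t $ i = 0" "fract_eval \<psi> $ i = 0" using t(2) c unfolding \<psi>_def by blast+
    then show ?thesis by simp
  qed
  moreover have e: "\<phi> - (\<Sum>k<Suc m. const_fract ((c(m := b)) k) * uniformizer ^ k)
      = \<psi> - const_fract b * uniformizer ^ m"
    by (simp add: \<psi>_def)
  ultimately have "\<forall>i<Suc m. fract_eval (\<phi> - (\<Sum>k<Suc m. const_fract ((c(m := b)) k) * uniformizer ^ k)) $ i = 0"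
    by (intro allI impI) (simp only:)
  then show ?case by blast
qed

lemma inj_uniformizer_power: "inj ((^) uniformizer)"
  by (metis injI uniformizer_power(3))

lemma intersection_mult_lower:
  assumes B: "finite B" "B \<subseteq> local_ring"
    and span: "\<forall>f\<in>local_ring. \<exists>c. f - (\<Sum>b\<in>B. const_fract (c b) * b) \<in> hyperplane_ideal a"
    and m: "branch_eval (linear_form (p - 1) a) = 0 \<or> m \<le> subdegree (branch_eval (linear_form (p - 1) a))"
  shows "m \<le> card B"
proof -
  define T where "T = (\<lambda>b. fps_cutoff m (fract_eval b)) ` B"
  define s where "s k = fps_cutoff m (fract_eval (uniformizer ^ k))" for k
  have sub: "s k \<noteq> 0" "subdegree (s k) = k" if "k < m" for k
  proof -
    let ?t = "fract_eval (uniformizer ^ k)"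
    have "?t $ k \<noteq> 0" "\<And>i. i < k \<Longrightarrow> ?t $ i = 0"
      using nth_subdegree_nonzero[OF uniformizer_power(2)[of k]] nth_less_subdegree_zero[of _ ?t]
      unfolding uniformizer_power(3) by blast+
    then have *: "s k $ k \<noteq> 0" "\<And>i. i < k \<Longrightarrow> s k $ i = 0"
      using that by (simp_all add: s_def)
    then show "subdegree (s k) = k" by (rule subdegreeI)
    show "s k \<noteq> 0" using *(1) by force
  qed
  have inj: "inj_on s {..<m}"
    by (rule inj_on_inverseI[where g = subdegree]) (simp only: sub lessThan_iff)
  have "fps_vs.independent (s ` {..<m})"
  proof (rule independent_of_subdegree)
    show "0 \<notin> s ` {..<m}" using sub(1) by (metis imageE lessThan_iff)
    show "inj_on subdegree (s ` {..<m})"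
      by (rule inj_on_inverseI[where g = s]) (auto simp only: sub lessThan_iff)
  qed
  moreover have "s ` {..<m} \<subseteq> fps_vs.span T"
  proof
    fix y assume "y \<in> s ` {..<m}"
    then obtain k where y: "y = s k" by blast
    obtain c where c: "uniformizer ^ k - (\<Sum>b\<in>B. const_fract (c b) * b) \<in> hyperplane_ideal a"
      using span uniformizer_power(1) by blast
    have terms: "const_fract (c b) * b \<in> local_ring" if "b \<in> B" for b
      using that B(2) by (intro local_ring_mult local_ring_const) blast
    have sum: "(\<Sum>b\<in>B. const_fract (c b) * b) \<in> local_ring"
      "fract_eval (\<Sum>b\<in>B. const_fract (c b) * b) = (\<Sum>b\<in>B. fract_eval (const_fract (c b) * b))"
      using local_ring_sum[of B "\<lambda>b. const_fract (c b) * b"] terms by blast+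
    have ev: "fract_eval (\<Sum>b\<in>B. const_fract (c b) * b) = (\<Sum>b\<in>B. fps_const (c b) * fract_eval b)"
    proof -
      have "(\<Sum>b\<in>B. fract_eval (const_fract (c b) * b)) = (\<Sum>b\<in>B. fps_const (c b) * fract_eval b)"
      proof (rule sum.cong)
        fix b assume "b \<in> B"
        then have "b \<in> local_ring" using B(2) by blast
        from local_ring_mult(2)[OF local_ring_const(1) this]
        show "fract_eval (const_fract (c b) * b) = fps_const (c b) * fract_eval b"
          by (simp only: local_ring_const(2))
      qed simp
      then show ?thesis unfolding sum(2) .
    qed
    obtain z where z: "fract_eval (uniformizer ^ k - (\<Sum>b\<in>B. const_fract (c b) * b))
        = branch_eval (linear_form (p - 1) a) * z"
      using fract_eval_hyperplane_ideal[OF c] by blast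
    have "branch_eval (linear_form (p - 1) a) $ i = 0" if "i < m" for i
      using m that nth_less_subdegree_zero[of i "branch_eval (linear_form (p - 1) a)"] by force
    then have "(branch_eval (linear_form (p - 1) a) * z) $ i = 0" if "i < m" for i
      using that by (simp add: fps_mult_nth)
    moreover have "fract_eval (uniformizer ^ k) - (\<Sum>b\<in>B. fps_const (c b) * fract_eval b)
        = branch_eval (linear_form (p - 1) a) * z"
      using z unfolding local_ring_diff(2)[OF uniformizer_power(1) sum(1)] ev .
    ultimately have "(fract_eval (uniformizer ^ k) - (\<Sum>b\<in>B. fps_const (c b) * fract_eval b)) $ i = 0"
      if "i < m" for i using that by (simp only:)
    then have eq: "fract_eval (uniformizer ^ k) $ i = (\<Sum>b\<in>B. fps_const (c b) * fract_eval b) $ i" if "i < m" for i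
      using that by (simp only: fps_sub_nth right_minus_eq)
    have "y = (\<Sum>b\<in>B. fps_const (c b) * fps_cutoff m (fract_eval b))"
    proof (rule fps_ext)
      fix i
      show "y $ i = (\<Sum>b\<in>B. fps_const (c b) * fps_cutoff m (fract_eval b)) $ i"
        using eq[of i] by (cases "i < m") (simp_all add: y s_def fps_sum_nth)
    qed
    also have "\<dots> \<in> fps_vs.span T"
      by (intro fps_vs.span_sum fps_vs.span_scale fps_vs.span_base) (simp add: T_def)
    finally show "y \<in> fps_vs.span T" .
  qed
  moreover have "finite T" using B(1) by (simp add: T_def)
  ultimately have "card (s ` {..<m}) \<le> card T" using fps_vs.independent_span_bound by blast
  also have "\<dots> \<le> card B" unfolding T_def using B(1) by (rule card_image_le)
  finally show ?thesis using inj by (simp add: card_image)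
qed

lemma intersection_mult_finite:
  assumes l: "branch_eval (linear_form (p - 1) a) \<noteq> 0"
  shows "intersection_mult (p - 1) V \<theta> a = enat (subdegree (branch_eval (linear_form (p - 1) a)))"
  unfolding intersection_mult_def quotient_dim_def
proof (rule antisym)
  define m where "m = subdegree (branch_eval (linear_form (p - 1) a))"
  define B where "B = (\<lambda>k. uniformizer ^ k) ` {..<m}"
  have inj: "inj_on (\<lambda>k. uniformizer ^ k) {..<m}" by (rule inj_on_subset[OF inj_uniformizer_power]) blast
  have "\<exists>c. f - (\<Sum>b\<in>B. const_fract (c b) * b) \<in> hyperplane_ideal a" if f: "f \<in> local_ring" for f
  proof -
    obtain c where c: "\<forall>i<m. fract_eval (f - (\<Sum>k<m. const_fract (c k) * uniformizer ^ k)) $ i = 0"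
      using uniformizer_expansion[OF f] by blast
    then have "f - (\<Sum>k<m. const_fract (c k) * uniformizer ^ k) \<in> hyperplane_ideal a"
      unfolding m_def by (intro hyperplane_idealI l local_ring_diff f uniformizer_sum) blast
    \<comment> \<open>Coefficients are indexed by the elements of \<open>B\<close>, not by
      exponents, hence the inverse of the injective power map.\<close>
    moreover have "(\<Sum>b\<in>B. const_fract (c (inv_into {..<m} (\<lambda>k. uniformizer ^ k) b)) * b)
        = (\<Sum>k<m. const_fract (c k) * uniformizer ^ k)"
      unfolding B_def sum.reindex[OF inj] comp_def
      by (rule sum.cong) (simp_all only: inv_into_f_f[OF inj])
    ultimately show ?thesis
      by (intro exI[of _ "\<lambda>b. c (inv_into {..<m} (\<lambda>k. uniformizer ^ k) b)"]) (simp only:)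
  qed
  moreover have "finite B" "B \<subseteq> local_ring"
    unfolding B_def using uniformizer_power(1) by blast+
  moreover have "card B = m" unfolding B_def card_image[OF inj] by (rule card_lessThan)
  ultimately have "enat m \<in> {enat (card B) | B. finite B \<and> B \<subseteq> local_ring \<and>
      (\<forall>f\<in>local_ring. \<exists>c. f - (\<Sum>b\<in>B. const_fract (c b) * b) \<in> hyperplane_ideal a)}"
    by (intro CollectI exI[of _ B] conjI ballI) simp_all
  then show "Inf {enat (card B) | B. finite B \<and> B \<subseteq> local_ring \<and>
      (\<forall>f\<in>local_ring. \<exists>c. f - (\<Sum>b\<in>B. const_fract (c b) * b) \<in> hyperplane_ideal a)}
    \<le> enat (subdegree (branch_eval (linear_form (p - 1) a)))"
    unfolding m_def by (rule Inf_lower)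
  show "enat (subdegree (branch_eval (linear_form (p - 1) a))) \<le> Inf {enat (card B) | B. finite B \<and> B \<subseteq> local_ring \<and>
      (\<forall>f\<in>local_ring. \<exists>c. f - (\<Sum>b\<in>B. const_fract (c b) * b) \<in> hyperplane_ideal a)}"
    proof (rule Inf_greatest)
    fix y assume "y \<in> {enat (card B) | B. finite B \<and> B \<subseteq> local_ring \<and>
      (\<forall>f\<in>local_ring. \<exists>c. f - (\<Sum>b\<in>B. const_fract (c b) * b) \<in> hyperplane_ideal a)}"
    then obtain B where B: "y = enat (card B)" "finite B" "B \<subseteq> local_ring"
      "\<forall>f\<in>local_ring. \<exists>c. f - (\<Sum>b\<in>B. const_fract (c b) * b) \<in> hyperplane_ideal a" by blast
    then have "subdegree (branch_eval (linear_form (p - 1) a)) \<le> card B"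
      by (intro intersection_mult_lower[where a = a]) simp_all
    then show "enat (subdegree (branch_eval (linear_form (p - 1) a))) \<le> y" by (simp add: B(1))
  qed
qed

lemma intersection_mult_infinite:
  assumes l: "branch_eval (linear_form (p - 1) a) = 0"
  shows "intersection_mult (p - 1) V \<theta> a = \<infinity>"
proof -
  have "\<not> (finite B \<and> B \<subseteq> local_ring \<and>
      (\<forall>f\<in>local_ring. \<exists>c. f - (\<Sum>b\<in>B. const_fract (c b) * b) \<in> hyperplane_ideal a))" for B
  proof
    assume "finite B \<and> B \<subseteq> local_ring \<and>
      (\<forall>f\<in>local_ring. \<exists>c. f - (\<Sum>b\<in>B. const_fract (c b) * b) \<in> hyperplane_ideal a)"
    then have "Suc (card B) \<le> card B" using l by (intro intersection_mult_lower[where a = a]) auto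
    then show False by simp
  qed
  then show ?thesis unfolding intersection_mult_def quotient_dim_def by (simp add: Inf_enat_def)
qed

end

section \<open>Orders at rational points\<close>

context curve_point
begin

interpretation series: branch_series p "branch p (1 :: 'a)" "1 - 2 * fps_X * branch p (1 :: 'a)"
  by unfold_locales (fact prime CHAR p7)+

lemma theta_power_sum:
  "(\<Sum>i\<in>{1..p - 1}. \<theta> i ^ e) = (if (p - 1) dvd e then - 1 else 0)"
proof -
  have "\<theta> i ^ e = \<theta> i ^ (e mod (p - 1))" if "i \<in> {1..p - 1}" for i
  proof -
    have "\<theta> i ^ e = (\<theta> i ^ (p - 1)) ^ (e div (p - 1)) * \<theta> i ^ (e mod (p - 1))"
      by (metis mult_div_mod_eq power_add power_mult)
    then show ?thesis unfolding theta_power[OF that] by simp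
  qed
  then have *: "(\<Sum>i\<in>{1..p - 1}. \<theta> i ^ e) = (\<Sum>i\<in>{1..p - 1}. \<theta> i ^ (e mod (p - 1)))"
    by (rule sum.cong[OF refl])
  have "e mod (p - 1) < p - 1" using p7 by simp
  then consider "e mod (p - 1) = 0" | "e mod (p - 1) \<in> {1..p - 3}" | "e mod (p - 1) = p - 2"
    by force
  then show ?thesis
  proof cases
    case 1
    then show ?thesis unfolding * using p7 by (simp add: dvd_eq_mod_eq_0 K.of_nat_p_minus)
  next
    case 2
    then have "\<not> (p - 1) dvd e" by (simp add: dvd_eq_mod_eq_0)
    then show ?thesis unfolding * K.power_sums_trinomial(1)[OF theta_trinomial 2] by simp
  next
    case 3
    then have "\<not> (p - 1) dvd e" using p7 by (simp add: dvd_eq_mod_eq_0)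
    then show ?thesis unfolding * 3 K.power_sums_trinomial(2)[OF theta_trinomial] by simp
  qed
qed

lemma branch_eval_linear_form:
  "branch_eval (linear_form (p - 1) a) = (\<Sum>i\<in>{1..p - 1}. fps_const (a i) * local_branch i)"
  by (simp only: linear_form_eq eval_fps.subst_sum eval_fps.subst_mult eval_fps.subst_const eval_fps.subst_var)

lemma curve_orders_cases:
  assumes "j \<in> curve_orders p \<theta>"
  obtains a where "is_hyperplane p a" "branch_eval (linear_form (p - 1) a) \<noteq> 0"
    "j = subdegree (branch_eval (linear_form (p - 1) a))"
proof -
  from assms obtain a where a: "is_hyperplane p a" "intersection_mult (p - 1) V \<theta> a = enat j"
    unfolding curve_orders_def by blast
  have nz: "branch_eval (linear_form (p - 1) a) \<noteq> 0"
    using a(2) intersection_mult_infinite[of a] by auto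
  then show thesis using that a intersection_mult_finite[of a] by simp
qed

text \<open>\<open>last_order\<close> is a \<open>Max\<close>, meaningful for finite sets only. The
  linear forms evaluate into the span of p - 1 series, where only finitely many orders
  occur.\<close>

lemma finite_curve_orders: "finite (curve_orders p \<theta>)"
proof (rule finite_subset)
  let ?S = "fps_vs.span (local_branch ` {1..p - 1})"
  show "finite (subdegree ` (?S - {0}))" by (rule finite_subdegrees_span) simp
  show "curve_orders p \<theta> \<subseteq> subdegree ` (?S - {0})"
  proof
    fix j assume "j \<in> curve_orders p \<theta>"
    then obtain a where a: "branch_eval (linear_form (p - 1) a) \<noteq> 0"
      "j = subdegree (branch_eval (linear_form (p - 1) a))" by (rule curve_orders_cases)
    have "branch_eval (linear_form (p - 1) a) \<in> ?S"
      unfolding branch_eval_linear_form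
      by (intro fps_vs.span_sum fps_vs.span_scale fps_vs.span_base imageI)
    then show "j \<in> subdegree ` (?S - {0})" using a by blast
  qed
qed

text \<open>The divisibility says that k is congruent to j modulo p - 1; the summand p - 1 avoids
  truncated subtraction when k < j.\<close>

lemma linear_form_nth:
  assumes "j \<le> p - 3"
  shows "branch_eval (linear_form (p - 1) (\<lambda>i. \<theta> i ^ (p - 2 - j))) $ k
    = (if (p - 1) dvd (p - 1 - j + k) then - of_nat (branch_coeff p k) else 0)"
proof -
  have e: "p - 2 - j + Suc k = p - 1 - j + k" using assms p7 by simp
  have "branch_eval (linear_form (p - 1) (\<lambda>i. \<theta> i ^ (p - 2 - j))) $ k
      = (\<Sum>i\<in>{1..p - 1}. of_nat (branch_coeff p k) * \<theta> i ^ (p - 1 - j + k))"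
    unfolding branch_eval_linear_form fps_sum_nth
    by (rule sum.cong) (simp_all only: fps_mult_left_const_nth local_branch_def branch_def fps_nth_Abs_fps
        e[symmetric] power_add mult_ac)
  also have "\<dots> = of_nat (branch_coeff p k) * (\<Sum>i\<in>{1..p - 1}. \<theta> i ^ (p - 1 - j + k))"
    by (simp only: sum_distrib_left)
  finally show ?thesis unfolding theta_power_sum by simp
qed

lemma is_hyperplane_power:
  assumes "1 \<le> j" "j \<le> p - 3"
  shows "is_hyperplane p (\<lambda>i. \<theta> i ^ (p - 2 - j))"
  unfolding is_hyperplane_def
proof (intro exI conjI)
  have "\<not> (p - 1) dvd (j + 1)" using assms p7 by (auto dest: dvd_imp_le)
  \<comment> \<open>The witness \<theta>_i^(j+1) is dual to the form: the products are
    \<theta>_i^(p-1) = 1, with sum -1, while its own sum vanishes because j + 1 lies strictly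
    between 0 and p - 1.\<close>
  then show "(\<Sum>i\<in>{1..p - 1}. \<theta> i ^ (j + 1)) = 0" unfolding theta_power_sum by simp
  have "p - 2 - j + (j + 1) = p - 1" using assms p7 by simp
  then have "(\<Sum>i\<in>{1..p - 1}. \<theta> i ^ (p - 2 - j) * \<theta> i ^ (j + 1)) = (\<Sum>i\<in>{1..p - 1}. \<theta> i ^ (p - 1))"
    by (simp only: power_add[symmetric])
  then show "(\<Sum>i\<in>{1..p - 1}. \<theta> i ^ (p - 2 - j) * \<theta> i ^ (j + 1)) \<noteq> 0"
    unfolding theta_power_sum by simp
qed

lemma curve_ordersI:
  assumes j: "1 \<le> j" "j \<le> p - 3"
    and nz: "branch_eval (linear_form (p - 1) (\<lambda>i. \<theta> i ^ (p - 2 - j))) \<noteq> 0"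
  shows "subdegree (branch_eval (linear_form (p - 1) (\<lambda>i. \<theta> i ^ (p - 2 - j)))) \<in> curve_orders p \<theta>"
  unfolding curve_orders_def using is_hyperplane_power[OF j] intersection_mult_finite[OF nz] by blast

lemma small_curve_orders: "{1, 2, 3} \<subseteq> curve_orders p \<theta>"
proof
  fix j :: nat assume j: "j \<in> {1, 2, 3}"
  then have j': "1 \<le> j" "j \<le> p - 3" using p7 by auto
  let ?L = "branch_eval (linear_form (p - 1) (\<lambda>i. \<theta> i ^ (p - 2 - j)))"
  have "?L $ i = 0" if "i < j" for i
  proof -
    have "0 < p - 1 - j + i" "p - 1 - j + i < p - 1" using that j' p7 by auto
    then have "\<not> (p - 1) dvd (p - 1 - j + i)" by (auto dest: dvd_imp_le)
    then show ?thesis unfolding linear_form_nth[OF j'(2)] by simp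
  qed
  moreover have L: "?L $ j \<noteq> 0"
  proof -
    have "p - 1 - j + j = p - 1" using j' by simp
    then show ?thesis unfolding linear_form_nth[OF j'(2)]
      using series.branch_coeff_small[OF j] by simp
  qed
  ultimately have "subdegree ?L = j" by (intro subdegreeI) blast+
  moreover have "?L \<noteq> 0" using L by force
  ultimately show "j \<in> curve_orders p \<theta>" using curve_ordersI[OF j'] by metis
qed

lemma large_curve_order: "\<exists>j\<in>curve_orders p \<theta>. 2 * p - 4 \<le> j"
proof -
  have j: "1 \<le> p - 3" "p - 3 \<le> p - 3" using p7 by auto
  have e: "p - 1 - (p - 3) + k = k + 2" for k using p7 by simp
  let ?L = "branch_eval (linear_form (p - 1) (\<lambda>i. \<theta> i ^ (p - 2 - (p - 3))))"
  obtain k where k: "(p - 1) dvd (k + 2)" "of_nat (branch_coeff p k) \<noteq> (0 :: 'a)"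
    using series.exists_branch_coeff_nonzero by blast
  have "?L $ k \<noteq> 0" unfolding linear_form_nth[OF j(2)] e using k by simp
  then have nz: "?L \<noteq> 0" by force
  have "2 * p - 4 \<le> subdegree ?L"
  proof (rule subdegree_geI[OF nz])
    fix i assume i: "i < 2 * p - 4"
    show "?L $ i = 0"
    proof (cases "(p - 1) dvd (i + 2)")
      case True
      then obtain c where c: "i + 2 = (p - 1) * c" by blast
      \<comment> \<open>Exponents k with p - 1 dividing k + 2 are p - 3, 2p - 4 and so on; below 2p
        - 4 only p - 3 occurs, where the coefficient vanishes.\<close>
      have "c < 2"
      proof (rule ccontr)
        assume "\<not> c < 2"
        then have "(p - 1) * 2 \<le> i + 2" unfolding c by (intro mult_le_mono) auto
        then show False using i p7 by simp
      qed
      moreover have "c \<noteq> 0" using c by (intro notI) simp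
      ultimately have "c = 1" by simp
      then have "i = p - 3" using c p7 by simp
      then show ?thesis unfolding linear_form_nth[OF j(2)]
        using series.branch_coeff_p_minus_3 by simp
    next
      case False
      then show ?thesis unfolding linear_form_nth[OF j(2)] e by simp
    qed
  qed
  then show ?thesis using curve_ordersI[OF j nz] by blast
qed

lemma last_order_ge: "2 * p - 4 \<le> last_order p \<theta>"
proof -
  obtain j where "j \<in> curve_orders p \<theta>" "2 * p - 4 \<le> j" using large_curve_order by blast
  then show ?thesis
    unfolding last_order_def using Max_ge[OF finite_curve_orders, of j] by linarith
qed

end

section \<open>Passage to an arbitrary coordinate vector of a rational point\<close>

lemma localize_scale:
  assumes c: "c \<noteq> 0"
  shows "localize n J (\<lambda>i. c * P i) = localize n J P"
proof -
  have "mpoly_eval (\<lambda>i. c * P i) G \<noteq> 0 \<longleftrightarrow> mpoly_eval P G \<noteq> 0" if "G \<in> homog n d" for G d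
    using mpoly_eval_homog_scale[OF that] c by simp
  then show ?thesis unfolding localize_def by blast
qed

lemma curve_orders_scale:
  assumes "c \<noteq> 0"
  shows "curve_orders p (\<lambda>i. c * P i) = curve_orders p P"
  unfolding curve_orders_def intersection_mult_def localize_scale[OF assms] ..

lemma curve_point_rational:
  fixes P :: "nat \<Rightarrow> 'a::alg_closed_field"
  assumes p: "prime p" "CHAR('a) = p" "7 \<le> p"
    and P: "P \<in> power_sum_curve p" and c: "c \<noteq> 0"
    and fixed: "\<And>i. i \<in> {1..p - 1} \<Longrightarrow> (c * P i) ^ p = c * P i"
  shows "curve_point p (\<lambda>i. c * P i)"
proof -
  have s: "(\<Sum>i\<in>{1..p - 1}. (c * P i) ^ k) = 0" if "k \<in> {1..p - 3}" for k
  proof -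
    have "(\<Sum>i\<in>{1..p - 1}. (c * P i) ^ k) = c ^ k * (\<Sum>i\<in>{1..p - 1}. P i ^ k)"
      by (simp only: power_mult_distrib sum_distrib_left)
    also have "(\<Sum>i\<in>{1..p - 1}. P i ^ k) = 0" using P that unfolding power_sum_curve_def by blast
    finally show ?thesis by simp
  qed
  have nz: "\<exists>i\<in>{1..p - 1}. c * P i \<noteq> 0"
    using P c unfolding power_sum_curve_def proj_points_def by auto
  show ?thesis
    by unfold_locales (use p rational_tuple(1,2)[OF p s fixed nz] in blast)+
qed

lemma range_to_ac_power:
  fixes z :: "'p::prime_card mod_ring alg_closure"
  assumes "z \<in> range to_ac"
  shows "z ^ CARD('p) = z"
proof -
  obtain y :: "'p mod_ring" where y: "z = to_ac y" using assms by blast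
  obtain k where k: "y = of_nat k" using surj_of_nat_mod_ring by blast
  have "y ^ CARD('p) = y"
    unfolding k by (rule of_nat_power_CHAR[OF prime_card]) simp
  then show ?thesis unfolding y to_ac_power[symmetric] by simp
qed

theorem proposition8p14:
  fixes p :: nat
    and P :: "nat \<Rightarrow> 'p::prime_card mod_ring alg_closure"
  assumes "p = CARD('p)" and "p \<ge> 7"
    and "P \<in> power_sum_curve p" and "rational_point (p - 1) P"
  shows "{1, 2, 3} \<subseteq> curve_orders p P \<and> last_order p P \<ge> 2 * p - 4"
proof -
  have p: "prime p" "CHAR('p mod_ring alg_closure) = p"
    using assms(1) prime_card[where 'a = 'p] by simp_all
  obtain c where c: "c \<noteq> 0" "\<And>i. i \<in> {1..p - 1} \<Longrightarrow> c * P i \<in> range to_ac"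
    using assms(4) unfolding rational_point_def by blast
  have "(c * P i) ^ p = c * P i" if "i \<in> {1..p - 1}" for i
    unfolding assms(1) by (rule range_to_ac_power) (rule c(2)[OF that])
  then interpret curve_point p "\<lambda>i. c * P i"
    by (intro curve_point_rational p assms c(1))
  show ?thesis
    using small_curve_orders last_order_ge unfolding last_order_def curve_orders_scale[OF c(1)] by simp
qed

end
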